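(* Let $S$ be a positive affine semigroup, and let $A$ be a noetherian connected $\mathbb N^l$-graded $\Bbbk$-algebra for some $l\in\mathbb N$. The algebra $A$ has a quantum affine toric degeneration with underlying semigroup $S$ if and only if there exist $t \in \mathbb N$ and an embedding (injective monoid morphism) $\iota:S\to\mathbb N^t$ such that $A$ has an $(S,<^\iota)$-basis.
   Context: $\Bbbk$ is a field. A connected $\mathbb N^l$-graded algebra has degree-$0$ component equal to $\Bbbk$. A positive affine semigroup is a monoid isomorphic to a finitely generated submonoid of some $\mathbb N^m$. For an embedding $\iota:S\to\mathbb N^t$, $<^\iota$ is the pull-back to $S$ of the lexicographic order on $\mathbb N^t$; it is a well-order on $S$ compatible with addition. $(S,<)$-basis: for $<$ a well-order on $S$ compatible with addition ($s<s'$ implies $s+s''<s'+s''$), an $(S,<)$-basis of $A$ is a vector space basis $\{b_s\mid s\in S\}$ of $A$ consisting of homogeneous elements such that for all $s,s'\in S$ there exist $c_{s,s'}\in\Bbbk^\times$ and $c_{s,s'}^{s''}\in\Bbbk$ (almost all zero) with $b_sb_{s'}=c_{s,s'}b_{s+s'}+\sum_{s''<s+s'}c_{s,s'}^{s''}b_{s''}$. Quantum affine toric degeneration: a 2-cocycle on $S$ is $\alpha:S\times S\to\Bbbk^\times$ with $\alpha(s,s')\alpha(s+s',s'')=\alpha(s,s'+s'')\alpha(s',s'')$; $\Bbbk^\alpha[S]$ has basis $\{X^s\}_{s\in S}$ and product $X^sX^t=\alpha(s,t)X^{s+t}$. A connected $\mathbb N^k$-graded algebra is a quantum positive affine toric variety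 with underlying semigroup $S$ if it is isomorphic to some $\Bbbk^\alpha[S]$ with $X^s$ homogeneous of nonzero degree for all $s\neq0$ in the induced grading. $A$ has a quantum affine toric degeneration with underlying semigroup $S$ if it has a filtration $\Bbbk=F_0A\subset F_1A\subset\cdots$ (indexed by $\mathbb N$) with $\bigcup_nF_nA=A$, $F_nA\cdot F_mA\subset F_{n+m}A$, each $F_nA$ a finite-dimensional graded subspace, whose associated graded ring (an $\mathbb N^{l+1}$-graded algebra) is a quantum positive affine toric variety with underlying semigroup $S$. *)

theory Defs
  imports Complex_Main "HOL-Library.Poly_Mapping" "HOL-Algebra.QuotRing" "HOL-Algebra.Module"
begin

section \<open>Exponent vectors and positive affine semigroups\<close>

text \<open>
  \<open>NN n\<close> is the monoid of n-tuples of natural numbers, with coordinates indexed by 0, ..., n - 1.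
  The library order \<open><\<close> on the type \<open>nat \<Rightarrow>\<^sub>0 nat\<close> is the lexicographic one: the vectors are compared
  at the smallest index at which they differ.
\<close>

definition NN :: "nat \<Rightarrow> (nat \<Rightarrow>\<^sub>0 nat) set" where
  "NN n = {v. Poly_Mapping.keys v \<subseteq> {..<n}}"

inductive_set submonoid_gen :: "'m::comm_monoid_add set \<Rightarrow> 'm set" for G where
  zero: "0 \<in> submonoid_gen G"
| incl: "g \<in> G \<Longrightarrow> g \<in> submonoid_gen G"
| add: "u \<in> submonoid_gen G \<Longrightarrow> v \<in> submonoid_gen G \<Longrightarrow> u + v \<in> submonoid_gen G"

definition monoid_embedding :: "nat \<Rightarrow> ('s::comm_monoid_add \<Rightarrow> (nat \<Rightarrow>\<^sub>0 nat)) \<Rightarrow> bool" where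
  "monoid_embedding t \<iota> \<longleftrightarrow>
     (\<forall>s. \<iota> s \<in> NN t) \<and> \<iota> 0 = 0 \<and> (\<forall>s s'. \<iota> (s + s') = \<iota> s + \<iota> s') \<and> inj \<iota>"

definition positive_affine_semigroup :: "'s::comm_monoid_add itself \<Rightarrow> bool" where
  "positive_affine_semigroup (_ :: 's itself) \<longleftrightarrow>
     (\<exists>m G. \<exists>\<phi> :: 's \<Rightarrow> (nat \<Rightarrow>\<^sub>0 nat).
        finite G \<and> G \<subseteq> NN m \<and> monoid_embedding m \<phi> \<and> \<phi> ` UNIV = submonoid_gen G)"

section \<open>Connected graded algebras\<close>

locale algebra_over_field = vector_space scale
  for scale :: "'k::field \<Rightarrow> 'a::ring_1 \<Rightarrow> 'a" +
  assumes mult_scale_left: "scale c x * y = scale c (x * y)"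
    and mult_scale_right: "x * scale c y = scale c (x * y)"

text \<open>
  A grading is a family \<open>D\<close> of which only the members \<open>D v\<close> with \<open>v \<in> NN l\<close> matter.
\<close>

locale connected_graded_algebra = algebra_over_field scale
  for scale :: "'k::field \<Rightarrow> 'a::ring_1 \<Rightarrow> 'a" +
  fixes l :: nat and D :: "(nat \<Rightarrow>\<^sub>0 nat) \<Rightarrow> 'a set"
  assumes subspace_component: "v \<in> NN l \<Longrightarrow> subspace (D v)"
    and direct_sum: "\<exists>!c :: (nat \<Rightarrow>\<^sub>0 nat) \<Rightarrow>\<^sub>0 'a.
           Poly_Mapping.keys c \<subseteq> NN l \<and>
           (\<forall>v \<in> NN l. Poly_Mapping.lookup c v \<in> D v) \<and>
           a = (\<Sum>v \<in> Poly_Mapping.keys c. Poly_Mapping.lookup c v)"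
    and component_mult:
      "u \<in> NN l \<Longrightarrow> v \<in> NN l \<Longrightarrow> x \<in> D u \<Longrightarrow> y \<in> D v \<Longrightarrow> x * y \<in> D (u + v)"
    and connected: "D 0 = {scale c 1 | c. True}"

definition left_ideal :: "'a::ring_1 set \<Rightarrow> bool" where
  "left_ideal J \<longleftrightarrow> 0 \<in> J \<and> (\<forall>x \<in> J. \<forall>y \<in> J. x + y \<in> J) \<and> (\<forall>r. \<forall>x \<in> J. r * x \<in> J)"

definition right_ideal :: "'a::ring_1 set \<Rightarrow> bool" where
  "right_ideal J \<longleftrightarrow> 0 \<in> J \<and> (\<forall>x \<in> J. \<forall>y \<in> J. x + y \<in> J) \<and> (\<forall>r. \<forall>x \<in> J. x * r \<in> J)"

definition noetherian :: "'a::ring_1 itself \<Rightarrow> bool" where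
  "noetherian (_ :: 'a itself) \<longleftrightarrow>
     (\<forall>J :: nat \<Rightarrow> 'a set. (\<forall>n. left_ideal (J n)) \<and> (\<forall>n. J n \<subseteq> J (Suc n))
        \<longrightarrow> (\<exists>N. \<forall>n \<ge> N. J n = J N)) \<and>
     (\<forall>J :: nat \<Rightarrow> 'a set. (\<forall>n. right_ideal (J n)) \<and> (\<forall>n. J n \<subseteq> J (Suc n))
        \<longrightarrow> (\<exists>N. \<forall>n \<ge> N. J n = J N))"

section \<open>Bases adapted to an ordered semigroup\<close>

definition compatible_well_order :: "('s::comm_monoid_add \<Rightarrow> 's \<Rightarrow> bool) \<Rightarrow> bool" where
  "compatible_well_order lt \<longleftrightarrow>
     class.wellorder (\<lambda>s s'. s = s' \<or> lt s s') lt \<and>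
     (\<forall>s s' s''. lt s s' \<longrightarrow> lt (s + s'') (s' + s''))"

definition semigroup_basis ::
  "('k::field \<Rightarrow> 'a::ring_1 \<Rightarrow> 'a) \<Rightarrow> nat \<Rightarrow> ((nat \<Rightarrow>\<^sub>0 nat) \<Rightarrow> 'a set)
     \<Rightarrow> ('s::comm_monoid_add \<Rightarrow> 's \<Rightarrow> bool) \<Rightarrow> ('s \<Rightarrow> 'a) \<Rightarrow> bool" where
  "semigroup_basis scale l D lt b \<longleftrightarrow>
     compatible_well_order lt \<and>
     inj b \<and> \<not> module.dependent scale (b ` UNIV) \<and> module.span scale (b ` UNIV) = UNIV \<and>
     (\<forall>s. \<exists>v \<in> NN l. b s \<in> D v) \<and>
     (\<forall>s s'. \<exists>c. \<exists>d :: 's \<Rightarrow>\<^sub>0 'k.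
        c \<noteq> 0 \<and> (\<forall>s'' \<in> Poly_Mapping.keys d. lt s'' (s + s')) \<and>
        b s * b s' = scale c (b (s + s')) +
          (\<Sum>s'' \<in> Poly_Mapping.keys d. scale (Poly_Mapping.lookup d s'') (b s'')))"

section \<open>Quantum positive affine toric varieties\<close>

text \<open>
  The algebras built below do not live on whole types; they are given by the record of
  operations of \<open>HOL-Algebra\<close>, with the field of scalars remaining a type.
\<close>

definition algebra_iso :: "('k, 'b) module \<Rightarrow> ('k, 'c) module \<Rightarrow> ('b \<Rightarrow> 'c) set" where
  "algebra_iso R R' = {h \<in> ring_iso R R'.
     \<forall>c. \<forall>x \<in> carrier R. h (c \<odot>\<^bsub>R\<^esub> x) = c \<odot>\<^bsub>R'\<^esub> h x}"

definition two_cocycle :: "('s::comm_monoid_add \<Rightarrow> 's \<Rightarrow> 'k::field) \<Rightarrow> bool" where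
  "two_cocycle \<alpha> \<longleftrightarrow> (\<forall>s s'. \<alpha> s s' \<noteq> 0) \<and>
     (\<forall>s s' s''. \<alpha> s s' * \<alpha> (s + s') s'' = \<alpha> s (s' + s'') * \<alpha> s' s'')"

text \<open>
  \<open>Poly_Mapping.single s 1\<close> is the basis element \<open>X\<^sup>s\<close>. Cocycles are not normalised, so the unit is
  \<open>\<alpha>(0,0)\<^sup>-\<^sup>1 X\<^sup>0\<close>.
\<close>

definition twisted_semigroup_algebra ::
  "('s::comm_monoid_add \<Rightarrow> 's \<Rightarrow> 'k::field) \<Rightarrow> ('k, 's \<Rightarrow>\<^sub>0 'k) module" where
  "twisted_semigroup_algebra \<alpha> =
     \<lparr> carrier = UNIV,
       mult = (\<lambda>x y. \<Sum>s \<in> Poly_Mapping.keys x. \<Sum>s' \<in> Poly_Mapping.keys y.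
                 Poly_Mapping.single (s + s')
                   (Poly_Mapping.lookup x s * Poly_Mapping.lookup y s' * \<alpha> s s')),
       one = Poly_Mapping.single 0 (inverse (\<alpha> 0 0)),
       zero = 0,
       add = (+),
       smult = (\<lambda>c. Poly_Mapping.map (\<lambda>z. c * z)) \<rparr>"

text \<open>
  Here \<open>R\<close> with the grading \<open>G\<close> over \<open>NN k\<close> is understood to be a connected graded algebra; this is
  automatic for the associated graded rings of the filtrations considered below.
\<close>

definition quantum_positive_affine_toric_variety ::
  "'s::comm_monoid_add itself \<Rightarrow> nat \<Rightarrow> ('k::field, 'b) module \<Rightarrow> ((nat \<Rightarrow>\<^sub>0 nat) \<Rightarrow> 'b set) \<Rightarrow> bool"
  where
  "quantum_positive_affine_toric_variety (_ :: 's itself) k R G \<longleftrightarrow>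
     (\<exists>\<alpha> :: 's \<Rightarrow> 's \<Rightarrow> 'k. two_cocycle \<alpha> \<and>
       (\<exists>h \<in> algebra_iso (twisted_semigroup_algebra \<alpha>) R.
          \<forall>s. s \<noteq> 0 \<longrightarrow> (\<exists>v \<in> NN k. v \<noteq> 0 \<and> h (Poly_Mapping.single s 1) \<in> G v)))"

section \<open>Filtrations and associated graded rings\<close>

definition graded_subspace ::
  "('k::field \<Rightarrow> 'a::ring_1 \<Rightarrow> 'a) \<Rightarrow> nat \<Rightarrow> ((nat \<Rightarrow>\<^sub>0 nat) \<Rightarrow> 'a set) \<Rightarrow> 'a set \<Rightarrow> bool" where
  "graded_subspace scale l D W \<longleftrightarrow>
     module.subspace scale W \<and> W = module.span scale (\<Union>v \<in> NN l. W \<inter> D v)"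

definition finite_dimensional ::
  "('k::field \<Rightarrow> 'a::ring_1 \<Rightarrow> 'a) \<Rightarrow> 'a set \<Rightarrow> bool" where
  "finite_dimensional scale W \<longleftrightarrow> (\<exists>B. finite B \<and> W = module.span scale B)"

definition graded_filtration ::
  "('k::field \<Rightarrow> 'a::ring_1 \<Rightarrow> 'a) \<Rightarrow> nat \<Rightarrow> ((nat \<Rightarrow>\<^sub>0 nat) \<Rightarrow> 'a set) \<Rightarrow> (nat \<Rightarrow> 'a set) \<Rightarrow> bool"
  where
  "graded_filtration scale l D F \<longleftrightarrow>
     F 0 = {scale c 1 | c. True} \<and>
     (\<forall>n. F n \<subseteq> F (Suc n)) \<and>
     (\<Union>n. F n) = UNIV \<and>
     (\<forall>n m. \<forall>x \<in> F n. \<forall>y \<in> F m. x * y \<in> F (n + m)) \<and>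
     (\<forall>n. graded_subspace scale l D (F n) \<and> finite_dimensional scale (F n))"

definition filt_pred :: "(nat \<Rightarrow> 'a::ring_1 set) \<Rightarrow> nat \<Rightarrow> 'a set" where
  "filt_pred F n = (case n of 0 \<Rightarrow> {0} | Suc m \<Rightarrow> F m)"

text \<open>
  An element of the associated graded ring is a sequence \<open>x\<close> whose n-th entry is a coset of
  \<open>filt_pred F n\<close> in \<open>F n\<close>, almost all entries being the zero coset \<open>filt_pred F n\<close>. In \<open>mult\<close>,
  the n-th entry is the class of the sum of the products of representatives in
  complementary degrees.
\<close>

definition assoc_graded ::
  "('k::field \<Rightarrow> 'a::ring_1 \<Rightarrow> 'a) \<Rightarrow> (nat \<Rightarrow> 'a set) \<Rightarrow> ('k, nat \<Rightarrow> 'a set) module" where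
  "assoc_graded scale F =
     \<lparr> carrier = {x. (\<forall>n. \<exists>a \<in> F n. x n = (+) a ` filt_pred F n) \<and> finite {n. x n \<noteq> filt_pred F n}},
       mult = (\<lambda>x y n. {(\<Sum>i\<le>n. a i * b (n - i)) + f | a b f.
                 (\<forall>i\<le>n. a i \<in> x i) \<and> (\<forall>i\<le>n. b i \<in> y i) \<and> f \<in> filt_pred F n}),
       one = (\<lambda>n. if n = 0 then {1} else filt_pred F n),
       zero = filt_pred F,
       add = (\<lambda>x y n. {a + b | a b. a \<in> x n \<and> b \<in> y n}),
       smult = (\<lambda>c x n. {scale c a + f | a f. a \<in> x n \<and> f \<in> filt_pred F n}) \<rparr>"

text \<open>
  The grading of the associated graded ring over \<open>NN (l + 1)\<close>: the coordinates below l form the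
  degree inherited from the algebra, the coordinate l is the filtration degree.
\<close>

definition assoc_grading ::
  "nat \<Rightarrow> ((nat \<Rightarrow>\<^sub>0 nat) \<Rightarrow> 'a::ring_1 set) \<Rightarrow> (nat \<Rightarrow> 'a set)
     \<Rightarrow> (nat \<Rightarrow>\<^sub>0 nat) \<Rightarrow> (nat \<Rightarrow> 'a set) set" where
  "assoc_grading l D F v =
     (let n = Poly_Mapping.lookup v l; d = Poly_Mapping.update l 0 v in
      {x. (\<exists>a \<in> F n \<inter> D d. x n = (+) a ` filt_pred F n) \<and> (\<forall>m. m \<noteq> n \<longrightarrow> x m = filt_pred F m)})"

definition has_quantum_affine_toric_degeneration ::
  "'s::comm_monoid_add itself \<Rightarrow> ('k::field \<Rightarrow> 'a::ring_1 \<Rightarrow> 'a) \<Rightarrow> nat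
     \<Rightarrow> ((nat \<Rightarrow>\<^sub>0 nat) \<Rightarrow> 'a set) \<Rightarrow> bool" where
  "has_quantum_affine_toric_degeneration S scale l D \<longleftrightarrow>
     (\<exists>F. graded_filtration scale l D F \<and>
          quantum_positive_affine_toric_variety S (l + 1) (assoc_graded scale F) (assoc_grading l D F))"

end

theory Submission
  imports Defs "HOL-Library.Multiset_Order"
begin

text \<open>
  Both sides are compared with bases whose structure constants are controlled by a single additive
  weight \<open>\<phi> : S \<rightarrow> \<nat>\<close>. The filtration degree of a degeneration is such a weight, and
  representatives of the classes \<open>X\<^sup>s\<close> form the basis; putting \<open>\<phi>\<close> in front of any embedding of \<open>S\<close>
  makes lower terms lexicographically smaller. Conversely, given an \<open>(S,<\<^sup>\<iota>)\<close>-basis, monomials in the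
  basis elements attached to generators of \<open>S\<close> span the algebra. By Dickson's lemma, finitely many
  straightening relations connect all monomials of the same degree, and the finitely many
  lexicographic inequalities in their lower terms are preserved by a suitable positive weight. The
  monomials then yield a basis adapted to this weight, and the resulting filtration has a twisted
  semigroup algebra as its associated graded ring.
\<close>

section \<open>Dickson's lemma and the lexicographic order\<close>

text \<open>The given basis cannot be kept when passing from the lexicographic order to a weight.
  Every vector (0,k) lies lexicographically below (1,0), so an additive weight with natural values
  that respected the whole order would have to vanish on (0,1), although (0,1) lies above 0. Only
  finitely many inequalities can be preserved at a time, while \<open>semigroup_basis\<close> has
  one relation for every pair of elements of S. Words remove this infinity: the product of two words
  is their concatenation, without error term, so all information sits in the comparison of words of
  equal degree, and such a comparison survives multiplication by words on both sides. Two orders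
  then share the work for the new basis: the weight governs spanning and the lower terms of
  products, while linear independence is still read off from leading terms for the lexicographic
  order.\<close>

lemma nat_seq_incseq_subseq:
  fixes f :: "nat \<Rightarrow> nat"
  shows "\<exists>r. strict_mono r \<and> incseq (f \<circ> r)"
proof -
  obtain r where r: "strict_mono r" "monoseq (\<lambda>n. f (r n))"
    using seq_monosub by blast
  show ?thesis
  proof (cases "incseq (\<lambda>n. f (r n))")
    case True
    then show ?thesis using r by (auto simp: comp_def)
  next
    case False
    then have dec: "decseq (\<lambda>n. f (r n))" using r(2) by (auto simp: monoseq_iff)
    \<comment> \<open>A decreasing sequence of naturals is constant from the place where its minimum
      is attained.\<close>
    obtain N where N: "\<And>n. f (r N) \<le> f (r n)"
      using ex_has_least_nat[of "\<lambda>_. True" 0 "\<lambda>n. f (r n)"] by auto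
    have const: "f (r (n + N)) = f (r N)" for n
      using N[of "n + N"] decseqD[OF dec, of N "n + N"] by simp
    have "strict_mono (\<lambda>n. r (n + N))"
      using r(1) by (simp add: strict_mono_def)
    then show ?thesis
      by (intro exI[of _ "\<lambda>n. r (n + N)"]) (simp add: incseq_def const)
  qed
qed

text \<open>The subsequence is refined one coordinate at a time; passing to a further subsequence
  keeps the earlier coordinates increasing.\<close>

lemma dickson_subseq:
  fixes f :: "nat \<Rightarrow> 'i \<Rightarrow> nat"
  assumes "finite I"
  shows "\<exists>r. strict_mono r \<and> (\<forall>i\<in>I. incseq (\<lambda>n. f (r n) i))"
  using assms
proof (induction I rule: finite_induct)
  case empty
  show ?case by (auto intro: exI[of _ id] simp: strict_mono_def)
next
  case (insert j I)
  then obtain r where r: "strict_mono r" "\<And>i. i \<in> I \<Longrightarrow> incseq (\<lambda>n. f (r n) i)" by blast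
  obtain q where q: "strict_mono q" "incseq ((\<lambda>n. f (r n) j) \<circ> q)"
    using nat_seq_incseq_subseq by blast
  have "strict_mono (r \<circ> q)" using r(1) q(1) by (simp add: strict_mono_def)
  moreover have "incseq (\<lambda>n. f ((r \<circ> q) n) i)" if "i \<in> insert j I" for i
    using that r(2)[of i] q by (auto simp: incseq_def comp_def strict_mono_less_eq)
  ultimately show ?case by blast
qed

lemma dickson:
  fixes f :: "nat \<Rightarrow> 'i \<Rightarrow> nat"
  assumes "finite I"
  obtains m n where "m < n" "\<And>i. i \<in> I \<Longrightarrow> f m i \<le> f n i"
proof -
  obtain r where r: "strict_mono r" "\<And>i. i \<in> I \<Longrightarrow> incseq (\<lambda>n. f (r n) i)"
    using dickson_subseq[OF assms] by blast
  show ?thesis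
    using r(1) r(2) by (intro that[of "r 0" "r 1"]) (auto simp: strict_mono_def incseq_def)
qed

text \<open>Multisets over the finite set \<open>I\<close> are vectors of multiplicities. The
  minimal members of \<open>U\<close> form an antichain for inclusion, which is finite by Dickson's
  lemma, and descent in size reaches one of them.\<close>

lemma dickson_multiset_finite_basis:
  fixes U :: "'i multiset set"
  assumes "finite I" and U: "\<And>X. X \<in> U \<Longrightarrow> set_mset X \<subseteq> I"
  obtains V where "finite V" "V \<subseteq> U" "\<And>X. X \<in> U \<Longrightarrow> \<exists>Y\<in>V. Y \<subseteq># X"
proof -
  define V where "V = {Y \<in> U. \<forall>Z\<in>U. \<not> Z \<subset># Y}"
  have "finite V"
  proof (rule ccontr)
    assume "infinite V"
    then obtain f :: "nat \<Rightarrow> 'i multiset" where f: "inj f" "range f \<subseteq> V"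
      using infinite_countable_subset by blast
    obtain m n where mn: "m < n" "\<And>i. i \<in> I \<Longrightarrow> count (f m) i \<le> count (f n) i"
      using dickson[OF assms(1), of "\<lambda>n. count (f n)"] by blast
    have fU: "f m \<in> U" "f m \<in> V" "f n \<in> V" using f(2) by (auto simp: V_def)
    have "f m \<subseteq># f n"
      unfolding subseteq_mset_def
    proof
      fix i show "count (f m) i \<le> count (f n) i"
        using mn(2)[of i] U[OF fU(1)] by (metis count_eq_zero_iff le0 subsetD)
    qed
    moreover have "f m \<noteq> f n" using f(1) mn(1) by (auto dest: injD)
    ultimately show False using fU unfolding V_def by (auto simp: subset_mset.less_le)
  qed
  moreover have "\<exists>Y\<in>V. Y \<subseteq># X" if "X \<in> U" for X
    using that
  proof (induction X rule: measure_induct_rule[of size])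
    case (less X)
    show ?case
    proof (cases "X \<in> V")
      case False
      then obtain Z where "Z \<in> U" "Z \<subset># X" using less.prems by (auto simp: V_def)
      then show ?thesis using less.IH[of Z] mset_subset_size[of Z X]
        by (meson subset_mset.dual_order.trans subset_mset.less_imp_le)
    qed auto
  qed
  ultimately show ?thesis by (intro that[of V]) (auto simp: V_def)
qed

section \<open>The lexicographic order as a well-order\<close>

lemma less_poly_mapping_iff:
  fixes u v :: "'i::linorder \<Rightarrow>\<^sub>0 'b::{zero,linorder}"
  shows "u < v \<longleftrightarrow> (\<exists>k. Poly_Mapping.lookup u k < Poly_Mapping.lookup v k \<and>
    (\<forall>j<k. Poly_Mapping.lookup u j = Poly_Mapping.lookup v j))"
  by (simp add: less_poly_mapping.rep_eq less_fun_def)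

lemma NN_lookup: "v \<in> NN t \<Longrightarrow> t \<le> k \<Longrightarrow> Poly_Mapping.lookup v k = 0"
  by (force simp: NN_def Poly_Mapping.in_keys_iff)

lemma NN_iff: "v \<in> NN t \<longleftrightarrow> (\<forall>k\<ge>t. Poly_Mapping.lookup v k = 0)"
  by (auto simp: NN_def Poly_Mapping.in_keys_iff subset_iff) (metis less_not_refl not_le)

lemma NN_add: "u \<in> NN t \<Longrightarrow> v \<in> NN t \<Longrightarrow> u + v \<in> NN t"
  by (simp add: NN_iff Poly_Mapping.lookup_add)

lemma NN_zero: "0 \<in> NN t"
  by (simp add: NN_def)

text \<open>The bound on the number of coordinates is essential: the unit vectors of index 0, 1, 2,
  ... form an infinite descending chain. Within \<open>NN t\<close>, Dickson's lemma gives a later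
  member of a chain that dominates an earlier one in every coordinate, so it cannot be
  lexicographically smaller.\<close>

lemma wf_lex_NN: "wf {(u, v). u \<in> NN t \<and> v \<in> NN t \<and> u < v}"
  unfolding wf_iff_no_infinite_down_chain
proof
  assume "\<exists>f. \<forall>i. (f (Suc i), f i) \<in> {(u, v). u \<in> NN t \<and> v \<in> NN t \<and> u < v}"
  then obtain f where f: "\<And>i. f i \<in> NN t" "\<And>i. f (Suc i) < f i" by auto
  obtain m n where mn: "m < n"
    "\<And>i. i \<in> {..<t} \<Longrightarrow> Poly_Mapping.lookup (f m) i \<le> Poly_Mapping.lookup (f n) i"
    using dickson[of "{..<t}" "\<lambda>n. Poly_Mapping.lookup (f n)"] by blast
  have "f n < f m" using mn(1)
  proof (induction n)
    case (Suc n)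
    then show ?case using f(2)[of n] by (cases "m = n") auto
  qed simp
  then obtain k where k: "Poly_Mapping.lookup (f n) k < Poly_Mapping.lookup (f m) k"
    unfolding less_poly_mapping_iff by blast
  then show False
    using mn(2)[of k] NN_lookup[OF f(1), of k m] by (cases "k < t") auto
qed

lemma compatible_well_order_embedding:
  assumes "monoid_embedding t \<iota>"
  shows "compatible_well_order (\<lambda>s s'. \<iota> s < \<iota> s')"
proof -
  have \<iota>: "\<And>s. \<iota> s \<in> NN t" "\<And>s s'. \<iota> (s + s') = \<iota> s + \<iota> s'" "inj \<iota>"
    using assms by (auto simp: monoid_embedding_def)
  have wf: "wf {(s, s'). \<iota> s < \<iota> s'}"
    using wf_inv_image[OF wf_lex_NN[of t], of \<iota>] \<iota>(1) by (simp add: inv_image_def)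
  have "class.wellorder (\<lambda>s s'. s = s' \<or> \<iota> s < \<iota> s') (\<lambda>s s'. \<iota> s < \<iota> s')"
  proof (unfold_locales, goal_cases)
    case (5 x y)
    show ?case using injD[OF \<iota>(3), of x y] less_linear[of "\<iota> x" "\<iota> y"] by blast
  next
    case (6 P a)
    show ?case using wf_induct_rule[OF wf, of P a] 6 by auto
  qed auto
  then show ?thesis by (simp add: compatible_well_order_def \<iota>(2))
qed

section \<open>Weights approximating the lexicographic order\<close>

text \<open>The number whose digits in base \<open>M\<close> are the coordinates of
  \<open>v\<close>, coordinate 0 being the most significant; digits may exceed
  \<open>M\<close>.\<close>

primrec horner_weight :: "nat \<Rightarrow> nat \<Rightarrow> (nat \<Rightarrow>\<^sub>0 nat) \<Rightarrow> nat" where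
  "horner_weight M 0 v = 0"
| "horner_weight M (Suc t) v = M * horner_weight M t v + Poly_Mapping.lookup v t"

lemma horner_weight_add: "horner_weight M t (u + v) = horner_weight M t u + horner_weight M t v"
  by (induction t) (auto simp: Poly_Mapping.lookup_add algebra_simps)

lemma lookup_le_horner_weight:
  "M \<ge> 1 \<Longrightarrow> j < t \<Longrightarrow> Poly_Mapping.lookup v j \<le> horner_weight M t v"
proof (induction t)
  case (Suc t)
  show ?case
  proof (cases "j = t")
    case False
    then have "Poly_Mapping.lookup v j \<le> horner_weight M t v" using Suc by simp
    also have "\<dots> \<le> M * horner_weight M t v" using Suc.prems by simp
    finally show ?thesis by simp
  qed simp
qed simp

lemma horner_weight_cong:
  "(\<And>j. j < t \<Longrightarrow> Poly_Mapping.lookup u j = Poly_Mapping.lookup v j)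
    \<Longrightarrow> horner_weight M t u = horner_weight M t v"
  by (induction t) auto

text \<open>Only the smaller vector needs proper digits, below \<open>M\<close>: a gain of one at
  position k outweighs all the later digits of \<open>u\<close>, whatever those of \<open>v\<close>
  are.\<close>

lemma horner_weight_strict_mono:
  assumes "k < t" and "\<And>j. j < t \<Longrightarrow> Poly_Mapping.lookup u j < M"
    and "Poly_Mapping.lookup u k < Poly_Mapping.lookup v k"
    and "\<And>j. j < k \<Longrightarrow> Poly_Mapping.lookup u j = Poly_Mapping.lookup v j"
  shows "horner_weight M t u < horner_weight M t v"
  using assms
proof (induction t)
  case (Suc t)
  show ?case
  proof (cases "k = t")
    case True
    then show ?thesis using Suc.prems horner_weight_cong[of t u v M] by simp
  next
    case False
    then have "Suc (horner_weight M t u) \<le> horner_weight M t v" using Suc by simp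
    then have "M * Suc (horner_weight M t u) \<le> M * horner_weight M t v" by (rule mult_le_mono2)
    moreover have "Poly_Mapping.lookup u t < M" using Suc.prems by simp
    ultimately show ?thesis by simp
  qed
qed simp

lemma finite_NN_bounded: "finite {v \<in> NN t. \<forall>j<t. Poly_Mapping.lookup v j \<le> n}"
proof -
  have "inj_on (\<lambda>v. restrict (Poly_Mapping.lookup v) {..<t}) (NN t)"
  proof (rule inj_onI, rule poly_mapping_eqI)
    fix u v k assume *: "u \<in> NN t" "v \<in> NN t"
      "restrict (Poly_Mapping.lookup u) {..<t} = restrict (Poly_Mapping.lookup v) {..<t}"
    show "Poly_Mapping.lookup u k = Poly_Mapping.lookup v k"
    proof (cases "k < t")
      case True then show ?thesis using fun_cong[OF *(3), of k] by simp
    qed (use * NN_lookup in auto)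
  qed
  moreover have "finite ({..<t} \<rightarrow>\<^sub>E {..n})" by (intro finite_PiE) auto
  ultimately show ?thesis
    by (rule_tac inj_on_finite[OF inj_on_subset]) (auto split: if_splits)
qed

lemma exists_weight:
  fixes \<iota> :: "'s::comm_monoid_add \<Rightarrow> (nat \<Rightarrow>\<^sub>0 nat)"
  assumes "monoid_embedding t \<iota>" and "finite P" and P: "\<And>s s'. (s, s') \<in> P \<Longrightarrow> \<iota> s < \<iota> s'"
  obtains \<phi> :: "'s \<Rightarrow> nat" where "\<And>s s'. \<phi> (s + s') = \<phi> s + \<phi> s'"
    "\<And>s. \<phi> s = 0 \<Longrightarrow> s = 0" "\<And>n. finite {s. \<phi> s \<le> n}" "\<And>s s'. (s, s') \<in> P \<Longrightarrow> \<phi> s < \<phi> s'"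
proof -
  have \<iota>: "\<And>s. \<iota> s \<in> NN t" "\<And>s s'. \<iota> (s + s') = \<iota> s + \<iota> s'" "inj \<iota>" "\<iota> 0 = 0"
    using assms by (auto simp: monoid_embedding_def)
  define E where "E = (\<lambda>(p, j). Poly_Mapping.lookup (\<iota> (fst p)) j) ` (P \<times> {..<t})"
  \<comment> \<open>\<open>E\<close> holds the coordinates of the smaller sides only. Inserting 0
    covers an empty \<open>E\<close>, and \<open>Suc\<close> also ensures M \<ge> 1, so that the
    weight bounds every coordinate; this yields positivity and the finiteness of the sublevel
    sets.\<close>
  define M where "M = Suc (Max (insert 0 E))"
  have "finite E" using assms(2) by (simp add: E_def)
  then have M: "x \<in> E \<Longrightarrow> x < M" for x by (simp add: M_def less_Suc_eq_le)
  have M1: "M \<ge> 1" by (simp add: M_def)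
  define \<phi> where "\<phi> s = horner_weight M t (\<iota> s)" for s
  have le: "\<phi> s \<le> n \<Longrightarrow> \<forall>j<t. Poly_Mapping.lookup (\<iota> s) j \<le> n" for s n
    unfolding \<phi>_def using lookup_le_horner_weight[OF M1] le_trans by blast
  show ?thesis
  proof (rule that[of \<phi>])
    show "\<And>s s'. \<phi> (s + s') = \<phi> s + \<phi> s'"
      by (auto simp: \<phi>_def \<iota> horner_weight_add)
    fix s assume "\<phi> s = 0"
    then have "\<iota> s = \<iota> 0"
      using le[of s 0] \<iota>(1)[of s] by (intro poly_mapping_eqI) (metis \<iota>(4) NN_lookup le_zero_eq lookup_zero not_le)
    then show "s = 0" using \<iota>(3) by (auto dest: injD)
  next
    fix n
    have "\<iota> ` {s. \<phi> s \<le> n} \<subseteq> {v \<in> NN t. \<forall>j<t. Poly_Mapping.lookup v j \<le> n}"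
      using le \<iota>(1) by auto
    then show "finite {s. \<phi> s \<le> n}"
      using finite_subset[OF _ finite_NN_bounded] inj_on_subset[OF \<iota>(3) subset_UNIV]
      by (blast intro: finite_imageD)
  next
    fix s s' assume *: "(s, s') \<in> P"
    obtain k where k: "Poly_Mapping.lookup (\<iota> s) k < Poly_Mapping.lookup (\<iota> s') k"
      "\<And>j. j < k \<Longrightarrow> Poly_Mapping.lookup (\<iota> s) j = Poly_Mapping.lookup (\<iota> s') j"
      using P[OF *] unfolding less_poly_mapping_iff by blast
    have "k < t" using k(1) NN_lookup[OF \<iota>(1), of k s'] by (cases "k < t") auto
    moreover have "Poly_Mapping.lookup (\<iota> s) j < M" if "j < t" for j
      using * that by (intro M) (force simp: E_def)
    ultimately show "\<phi> s < \<phi> s'"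
      unfolding \<phi>_def using horner_weight_strict_mono k by blast
  qed
qed

text \<open>The generators are indexed by numbers because the semigroup carries no order: the linear
  order of the indices later supplies sorted lists and the multiset order.\<close>

lemma positive_affine_semigroup_generators:
  assumes "positive_affine_semigroup TYPE('s::comm_monoid_add)"
  obtains n and g :: "nat \<Rightarrow> 's::comm_monoid_add"
  where "\<And>s. \<exists>w. set w \<subseteq> {..<n} \<and> sum_list (map g w) = s"
proof -
  obtain m G and \<phi> :: "'s \<Rightarrow> (nat \<Rightarrow>\<^sub>0 nat)" where G: "finite G" "monoid_embedding m \<phi>"
    "\<phi> ` UNIV = submonoid_gen G"
    using assms by (auto simp: positive_affine_semigroup_def)
  have \<phi>: "\<phi> 0 = 0" "\<And>s s'. \<phi> (s + s') = \<phi> s + \<phi> s'" "inj \<phi>"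
    using G(2) by (auto simp: monoid_embedding_def)
  obtain xs where xs: "set xs = \<phi> -` G"
    using finite_list[OF finite_vimageI[OF G(1) \<phi>(3)]] by blast
  define g where "g i = xs ! i" for i
  have "\<exists>w. set w \<subseteq> {..<length xs} \<and> \<phi> (sum_list (map g w)) = v" if "v \<in> submonoid_gen G" for v
    using that
  proof induction
    case zero
    show ?case by (intro exI[of _ "[]"]) (simp add: \<phi>)
  next
    case (incl v)
    then have "v \<in> \<phi> ` UNIV" using G(3) submonoid_gen.incl by blast
    then obtain s where s: "v = \<phi> s" by blast
    then have "s \<in> set xs" using xs incl by simp
    then obtain i where "i < length xs" "xs ! i = s" by (auto simp: in_set_conv_nth)
    then show ?case using s by (intro exI[of _ "[i]"]) (simp add: g_def)
  next
    case (add u v)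
    then obtain w w' where "set w \<subseteq> {..<length xs}" "\<phi> (sum_list (map g w)) = u"
      "set w' \<subseteq> {..<length xs}" "\<phi> (sum_list (map g w')) = v" by blast
    then show ?case by (intro exI[of _ "w @ w'"]) (simp add: \<phi>)
  qed
  then have "\<exists>w. set w \<subseteq> {..<length xs} \<and> sum_list (map g w) = s" for s
    using G(3) \<phi>(3) by (metis injD rangeI)
  then show ?thesis using that by blast
qed

section \<open>Linear combinations of families\<close>

context algebra_over_field
begin

text \<open>The form of the lower terms in \<open>semigroup_basis\<close>. The sum runs over
  indices, so the family may repeat values or vanish at some indices.\<close>

definition comb :: "('s \<Rightarrow> 'a) \<Rightarrow> ('s \<Rightarrow>\<^sub>0 'k) \<Rightarrow> 'a" where
  "comb b d = (\<Sum>s\<in>Poly_Mapping.keys d. scale (Poly_Mapping.lookup d s) (b s))"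

lemma comb_superset:
  assumes "finite T" "Poly_Mapping.keys d \<subseteq> T"
  shows "comb b d = (\<Sum>s\<in>T. scale (Poly_Mapping.lookup d s) (b s))"
  unfolding comb_def using assms by (intro sum.mono_neutral_left) (auto simp: in_keys_iff)

lemma comb_zero [simp]: "comb b 0 = 0"
  by (simp add: comb_def)

lemma comb_add: "comb b (d + e) = comb b d + comb b e"
proof -
  let ?T = "Poly_Mapping.keys d \<union> Poly_Mapping.keys e"
  have "comb b (d + e) = (\<Sum>s\<in>?T. scale (Poly_Mapping.lookup (d + e) s) (b s))"
    by (rule comb_superset) (use keys_add[of d e] in auto)
  also have "\<dots> = comb b d + comb b e"
    by (simp add: comb_superset[of ?T] lookup_add scale_left_distrib sum.distrib)
  finally show ?thesis .
qed

lemma comb_sum: "comb b (sum f I) = (\<Sum>i\<in>I. comb b (f i))"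
  by (induction I rule: infinite_finite_induct) (auto simp: comb_add)

lemma comb_single [simp]: "comb b (Poly_Mapping.single s c) = scale c (b s)"
  by (simp add: comb_superset[of "{s}"])

lemma lookup_map_times:
  "Poly_Mapping.lookup (Poly_Mapping.map (\<lambda>z. c * z) d) s = (c :: 'k) * Poly_Mapping.lookup d s"
  by (simp add: Poly_Mapping.map.rep_eq when_def)

lemma comb_scale: "comb b (Poly_Mapping.map (\<lambda>z. c * z) d) = scale c (comb b d)"
proof -
  have "Poly_Mapping.keys (Poly_Mapping.map (\<lambda>z. c * z) d) \<subseteq> Poly_Mapping.keys d"
    by (auto simp: in_keys_iff lookup_map_times)
  then show ?thesis
    by (simp add: comb_superset[of "Poly_Mapping.keys d"] lookup_map_times scale_sum_right)
qed

lemma comb_in_span: "Poly_Mapping.keys d \<subseteq> T \<Longrightarrow> comb b d \<in> span (b ` T)"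
  unfolding comb_def by (intro span_sum span_scale span_base) auto

lemma span_image_comb:
  assumes "x \<in> span (b ` T)"
  obtains d where "Poly_Mapping.keys d \<subseteq> T" "x = comb b d"
proof -
  have "\<exists>d. Poly_Mapping.keys d \<subseteq> T \<and> x = comb b d"
    using assms
  proof (induction rule: span_induct_alt)
    case base
    show ?case by (intro exI[of _ 0]) simp
  next
    case (step c x y)
    then obtain s d where s: "s \<in> T" "x = b s" "Poly_Mapping.keys d \<subseteq> T" "y = comb b d" by blast
    show ?case
    proof (intro exI[of _ "Poly_Mapping.single s c + d"] conjI)
      show "Poly_Mapping.keys (Poly_Mapping.single s c + d) \<subseteq> T"
        using s keys_add[of "Poly_Mapping.single s c" d] by (auto split: if_splits)
    qed (simp add: s comb_add)
  qed
  then show ?thesis using that by blast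
qed

lemma comb_eq_0_iff:
  assumes "inj b" "independent (range b)"
  shows "comb b d = 0 \<longleftrightarrow> d = 0"
proof
  assume 0: "comb b d = 0"
  have "(\<Sum>x\<in>b ` Poly_Mapping.keys d. scale (Poly_Mapping.lookup d (inv_into UNIV b x)) x) = 0"
    using 0 assms(1) by (subst sum.reindex) (auto simp: comb_def intro: inj_on_subset)
  then have "Poly_Mapping.lookup d (inv_into UNIV b x) = 0" if "x \<in> b ` Poly_Mapping.keys d" for x
    using independentD[OF assms(2), of "b ` Poly_Mapping.keys d" "\<lambda>x. Poly_Mapping.lookup d (inv_into UNIV b x)" x]
      that by auto
  then have "Poly_Mapping.keys d = {}"
    using assms(1) by (metis ex_in_conv imageI in_keys_iff inv_into_f_f UNIV_I)
  then show "d = 0" by simp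
qed simp

text \<open>Injectivity has to be stated besides independence, since the set \<open>range b\<close>
  does not see repeated values; both follow from the independence of the indexed family.\<close>

lemma independent_range_if_comb:
  assumes "\<And>d :: 's \<Rightarrow>\<^sub>0 'k. comb b d = 0 \<Longrightarrow> d = 0"
  shows "inj b" "independent (range b)"
proof -
  show inj: "inj b"
  proof (rule injI, rule ccontr)
    fix s s' assume b: "b s = b s'" and ne: "s \<noteq> s'"
    have "comb b (Poly_Mapping.single s 1 + Poly_Mapping.single s' (-1)) = 0"
      by (simp add: comb_add b)
    then have "Poly_Mapping.single s (1::'k) + Poly_Mapping.single s' (-1) = 0" by (rule assms)
    from arg_cong[OF this, of "\<lambda>d. Poly_Mapping.lookup d s"] show False
      using ne by (simp add: lookup_add lookup_single)
  qed
  show "independent (range b)"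
    unfolding independent_explicit_module
  proof (intro allI impI)
    fix T u v assume T: "finite T" "T \<subseteq> range b" "(\<Sum>v\<in>T. scale (u v) v) = 0" "v \<in> T"
    define d where "d = (\<Sum>x\<in>T. Poly_Mapping.single (inv_into UNIV b x) (u x))"
    have "comb b d = 0"
      unfolding d_def comb_sum comb_single T(3)[symmetric]
      by (intro sum.cong) (use T(2) in \<open>auto simp: f_inv_into_f\<close>)
    then have "d = 0" by (rule assms)
    then have "0 = Poly_Mapping.lookup d (inv_into UNIV b v)" by simp
    also have "\<dots> = (\<Sum>x\<in>T. if x = v then u x else 0)"
      unfolding d_def lookup_sum
    proof (rule sum.cong)
      fix x assume "x \<in> T"
      then have "inv_into UNIV b x = inv_into UNIV b v \<longleftrightarrow> x = v" using T(2,4) by (metis f_inv_into_f subsetD)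
      then show "Poly_Mapping.lookup (Poly_Mapping.single (inv_into UNIV b x) (u x)) (inv_into UNIV b v)
          = (if x = v then u x else 0)"
        by (simp add: lookup_single)
    qed simp
    also have "\<dots> = u v" using T by simp
    finally show "u v = 0" by simp
  qed
qed

lemma span_mult_closed:
  assumes x: "x \<in> span X" and y: "y \<in> span Y"
    and XY: "\<And>x y. x \<in> X \<Longrightarrow> y \<in> Y \<Longrightarrow> x * y \<in> span Z"
  shows "x * y \<in> span Z"
proof -
  have 1: "x * y \<in> span Z" if "x \<in> X" for x
    using y by (induction rule: span_induct_alt)
      (auto simp: distrib_left mult_scale_right intro!: span_add span_scale span_zero XY that)
  show ?thesis
    using x by (induction rule: span_induct_alt)
      (auto simp: distrib_right mult_scale_left intro!: span_add span_scale span_zero 1)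
qed

end

section \<open>Homogeneous elements\<close>

context connected_graded_algebra
begin

lemma homogeneous_degree_unique:
  assumes "u \<in> NN l" "v \<in> NN l" "x \<in> D u" "x \<in> D v" "x \<noteq> 0"
  shows "u = v"
proof -
  \<comment> \<open>Placing \<open>x\<close> in degree u and placing it in degree v are both
    homogeneous decompositions of \<open>x\<close>, so they coincide.\<close>
  have "Poly_Mapping.keys (Poly_Mapping.single w x) \<subseteq> NN l \<and>
      (\<forall>v\<in>NN l. Poly_Mapping.lookup (Poly_Mapping.single w x) v \<in> D v) \<and>
      x = (\<Sum>v\<in>Poly_Mapping.keys (Poly_Mapping.single w x).
        Poly_Mapping.lookup (Poly_Mapping.single w x) v)"
    if "w \<in> NN l" "x \<in> D w" for w
    using that assms(5) by (auto simp: lookup_single when_def subspace_0 subspace_component)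
  then have "Poly_Mapping.single u x = Poly_Mapping.single v x"
    using direct_sum[of x] assms by blast
  then show ?thesis
    using assms(5) by (metis lookup_single_eq lookup_single_not_eq)
qed

text \<open>The square has degree 2v and is a nonzero multiple of an element of degree v, hence v =
  0, and connectedness leaves only scalars. This identifies the basis element attached to 0, which
  has no lower terms in its square.\<close>

lemma homogeneous_quasi_idempotent_scalar:
  assumes "v \<in> NN l" "x \<in> D v" "x \<noteq> 0" "x * x = scale c x" "c \<noteq> 0"
  obtains d where "d \<noteq> 0" "x = scale d 1"
proof -
  have "scale c x \<in> D (v + v)" using component_mult[OF assms(1,1,2,2)] assms(4) by simp
  moreover have "scale c x \<in> D v" using assms(1,2) subspace_component subspace_scale by blast
  moreover have "scale c x \<noteq> 0" using assms(3,5) by simp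
  ultimately have "v + v = v"
    using homogeneous_degree_unique NN_add assms(1) by blast
  then have "x \<in> D 0" using assms(2) by simp
  then show ?thesis using that assms(3) unfolding connected by auto
qed

lemma one_in_D0: "1 \<in> D 0"
  unfolding connected by (auto intro: exI[of _ 1])

text \<open>
  The intermediate notion between the two sides of the theorem: a basis whose structure constants
  are controlled by one additive weight \<open>\<phi>\<close> with values in the natural numbers.
\<close>

definition weighted_basis :: "('s::comm_monoid_add \<Rightarrow> nat) \<Rightarrow> ('s \<Rightarrow> 'a) \<Rightarrow> bool" where
  "weighted_basis \<phi> b \<longleftrightarrow>
     (\<forall>s s'. \<phi> (s + s') = \<phi> s + \<phi> s') \<and> (\<forall>s. \<phi> s = 0 \<longrightarrow> s = 0) \<and> (\<forall>n. finite {s. \<phi> s \<le> n}) \<and>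
     inj b \<and> independent (range b) \<and> span (range b) = UNIV \<and>
     (\<forall>s. \<exists>v\<in>NN l. b s \<in> D v) \<and>
     (\<forall>s s'. \<exists>c. c \<noteq> 0 \<and>
        b s * b s' - scale c (b (s + s')) \<in> span (b ` {u. \<phi> u < \<phi> (s + s')}))"

lemma semigroup_basis_if_weighted_basis:
  fixes \<phi> :: "'s::comm_monoid_add \<Rightarrow> nat" and \<psi> :: "'s \<Rightarrow> (nat \<Rightarrow>\<^sub>0 nat)"
  assumes emb: "monoid_embedding m \<psi>" and wb: "weighted_basis \<phi> b"
  shows "\<exists>\<iota> :: 's \<Rightarrow> (nat \<Rightarrow>\<^sub>0 nat). monoid_embedding (Suc m) \<iota> \<and>
    semigroup_basis scale l D (\<lambda>s s'. \<iota> s < \<iota> s') b"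
proof -
  have \<psi>: "\<And>s. \<psi> s \<in> NN m" "\<And>s s'. \<psi> (s + s') = \<psi> s + \<psi> s'" "inj \<psi>" "\<psi> 0 = 0"
    using emb by (auto simp: monoid_embedding_def)
  have \<phi>: "\<And>s s'. \<phi> (s + s') = \<phi> s + \<phi> s'"
    using wb by (simp add: weighted_basis_def)
  have \<phi>0: "\<phi> 0 = 0" using \<phi>[of 0 0] by simp
  \<comment> \<open>The weight becomes coordinate 0, the first to be compared, and
    \<open>\<psi>\<close> is shifted by one place; \<open>\<psi>\<close> only serves to keep the map
    injective.\<close>
  define \<iota> where "\<iota> s = Abs_poly_mapping (case_nat (\<phi> s) (Poly_Mapping.lookup (\<psi> s)))" for s
  have \<iota>: "Poly_Mapping.lookup (\<iota> s) k = case_nat (\<phi> s) (Poly_Mapping.lookup (\<psi> s)) k" for s k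
  proof -
    have "{k. case_nat (\<phi> s) (Poly_Mapping.lookup (\<psi> s)) k \<noteq> 0} \<subseteq> {..m}"
    proof
      fix k assume "k \<in> {k. case_nat (\<phi> s) (Poly_Mapping.lookup (\<psi> s)) k \<noteq> 0}"
      then show "k \<in> {..m}" using NN_lookup[OF \<psi>(1)[of s], of "k - 1"] by (cases k; cases "k \<le> m") auto
    qed
    then show ?thesis
      unfolding \<iota>_def by (subst lookup_Abs_poly_mapping) (auto intro: finite_subset)
  qed
  have "monoid_embedding (Suc m) \<iota>"
    unfolding monoid_embedding_def
  proof (intro conjI allI)
    show "\<iota> s \<in> NN (Suc m)" for s
      using NN_lookup[OF \<psi>(1)[of s]] by (auto simp: NN_iff \<iota> split: nat.splits)
    show "\<iota> 0 = 0" by (rule poly_mapping_eqI) (simp add: \<iota> \<phi>0 \<psi> split: nat.splits)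
    show "\<iota> (s + s') = \<iota> s + \<iota> s'" for s s'
      by (rule poly_mapping_eqI) (simp add: \<iota> \<phi> \<psi> lookup_add split: nat.splits)
    show "inj \<iota>"
    proof (rule injI)
      fix s s' assume eq: "\<iota> s = \<iota> s'"
      have "Poly_Mapping.lookup (\<psi> s) k = Poly_Mapping.lookup (\<psi> s') k" for k
        using arg_cong[OF eq, of "\<lambda>v. Poly_Mapping.lookup v (Suc k)"] by (simp add: \<iota>)
      then have "\<psi> s = \<psi> s'" by (rule poly_mapping_eqI)
      then show "s = s'" using \<psi>(3) by (auto dest: injD)
    qed
  qed
  moreover have "\<iota> s < \<iota> s'" if "\<phi> s < \<phi> s'" for s s'
    unfolding less_poly_mapping_iff using that by (intro exI[of _ 0]) (simp add: \<iota>)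
  moreover have "\<exists>c d. c \<noteq> 0 \<and> (\<forall>u\<in>Poly_Mapping.keys d. \<phi> u < \<phi> (s + s')) \<and>
        b s * b s' = scale c (b (s + s')) + comb b d" for s s'
  proof -
    obtain c where c: "c \<noteq> 0" "b s * b s' - scale c (b (s + s')) \<in> span (b ` {u. \<phi> u < \<phi> (s + s')})"
      using wb unfolding weighted_basis_def by blast
    obtain d where "Poly_Mapping.keys d \<subseteq> {u. \<phi> u < \<phi> (s + s')}"
      "b s * b s' - scale c (b (s + s')) = comb b d"
      using span_image_comb[OF c(2)] by blast
    then show ?thesis using c(1) by (intro exI[of _ c] exI[of _ d]) (auto simp: algebra_simps)
  qed
  ultimately show ?thesis
    using wb compatible_well_order_embedding
    unfolding semigroup_basis_def weighted_basis_def comb_def[symmetric] by metis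
qed

end

section \<open>From a semigroup basis to a weighted basis\<close>

locale generated_semigroup_basis = connected_graded_algebra scale l D
  for scale :: "'k::field \<Rightarrow> 'a::ring_1 \<Rightarrow> 'a" and l D +
  fixes t :: nat and \<iota> :: "'s::comm_monoid_add \<Rightarrow> (nat \<Rightarrow>\<^sub>0 nat)" and b :: "'s \<Rightarrow> 'a"
    and n :: nat and g :: "nat \<Rightarrow> 's"
  assumes embedding: "monoid_embedding t \<iota>"
    and basis: "semigroup_basis scale l D (\<lambda>s s'. \<iota> s < \<iota> s') b"
    and generators: "\<exists>w. set w \<subseteq> {..<n} \<and> sum_list (map g w) = s"
begin

lemma \<iota>_add: "\<iota> (s + s') = \<iota> s + \<iota> s'"
  and \<iota>_inj: "inj \<iota>"
  and \<iota>_zero: "\<iota> 0 = 0"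
  using embedding by (auto simp: monoid_embedding_def)

lemma wf_\<iota>: "wf {(s, s'). \<iota> s < \<iota> s'}"
  using wf_inv_image[OF wf_lex_NN[of t], of \<iota>] embedding
  by (simp add: inv_image_def monoid_embedding_def)

lemma b_inj: "inj b"
  and b_independent: "independent (range b)"
  and b_span: "span (range b) = UNIV"
  and b_homogeneous: "\<exists>v\<in>NN l. b s \<in> D v"
  using basis by (auto simp: semigroup_basis_def)

definition lower :: "'s \<Rightarrow> 'a set" where
  "lower s = span (b ` {u. \<iota> u < \<iota> s})"

lemma lower_mono: "\<iota> s \<le> \<iota> s' \<Longrightarrow> lower s \<subseteq> lower s'"
  unfolding lower_def by (rule span_mono) auto

lemma subspace_lower: "subspace (lower s)"
  by (simp add: lower_def)

lemma b_in_lower: "\<iota> s < \<iota> s' \<Longrightarrow> b s \<in> lower s'"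
  by (auto simp: lower_def intro: span_base)

lemma b_notin_lower: "b s \<notin> lower s"
proof -
  have "b s \<notin> span (range b - {b s})"
    using b_independent unfolding dependent_def by blast
  moreover have "lower s \<subseteq> span (range b - {b s})"
    unfolding lower_def using b_inj by (intro span_mono) (auto dest: injD)
  ultimately show ?thesis by blast
qed

lemma b_mult: "\<exists>c. c \<noteq> 0 \<and> b s * b s' - scale c (b (s + s')) \<in> lower (s + s')"
proof -
  obtain c d where "c \<noteq> 0" "\<forall>u \<in> Poly_Mapping.keys d. \<iota> u < \<iota> (s + s')"
    "b s * b s' = scale c (b (s + s')) + comb b d"
    using basis unfolding semigroup_basis_def comb_def by blast
  then show ?thesis
    using comb_in_span[of d "{u. \<iota> u < \<iota> (s + s')}" b]
    by (intro exI[of _ c]) (auto simp: lower_def)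
qed

lemma b_mult_in_lower:
  assumes "\<iota> u < \<iota> s'"
  shows "b s * b u \<in> lower (s + s')"
proof -
  have lt: "\<iota> (s + u) < \<iota> (s + s')" using assms by (simp add: \<iota>_add)
  obtain c where "b s * b u - scale c (b (s + u)) \<in> lower (s + u)" using b_mult by blast
  then have "b s * b u - scale c (b (s + u)) \<in> lower (s + s')" using lower_mono[of "s + u" "s + s'"] lt
    by (meson less_imp_le subsetD)
  moreover have "scale c (b (s + u)) \<in> lower (s + s')"
    using lt by (intro subspace_scale[OF subspace_lower] b_in_lower)
  ultimately show ?thesis using subspace_add[OF subspace_lower] by fastforce
qed

lemma b_mult_lower:
  assumes "x \<in> lower s'"
  shows "b s * x \<in> lower (s + s')"
  unfolding lower_def
  by (rule span_mult_closed[of _ "{b s}" _ "b ` {u. \<iota> u < \<iota> s'}"])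
    (use assms b_mult_in_lower in \<open>auto simp: lower_def span_base\<close>)

lemma b_zero: obtains c where "c \<noteq> 0" "b 0 = scale c 1"
proof -
  \<comment> \<open>No vector of naturals is lexicographically below 0.\<close>
  have "lower 0 = {0}"
    by (auto simp: lower_def \<iota>_zero less_poly_mapping_iff)
  then obtain c where c: "c \<noteq> 0" "b 0 * b 0 = scale c (b 0)"
    using b_mult[of 0 0] by auto
  have "b 0 \<noteq> 0" using b_notin_lower[of 0] subspace_0[OF subspace_lower] by metis
  then show ?thesis
    using homogeneous_quasi_idempotent_scalar[OF _ _ _ c(2,1)] b_homogeneous[of 0] that by blast
qed

section \<open>Words in the generators\<close>

definition word :: "nat list \<Rightarrow> 'a" where
  "word w = prod_list (map (\<lambda>i. b (g i)) w)"

text \<open>The degree in the semigroup, to be distinguished from the degree for the grading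
  \<open>D\<close>.\<close>

definition deg :: "nat list \<Rightarrow> 's" where
  "deg w = sum_list (map g w)"

definition words :: "nat list set" where
  "words = {w. set w \<subseteq> {..<n}}"

lemma word_append: "word (u @ v) = word u * word v"
  and deg_append: "deg (u @ v) = deg u + deg v"
  and words_append: "u @ v \<in> words \<longleftrightarrow> u \<in> words \<and> v \<in> words"
  by (auto simp: word_def deg_def words_def)

lemma ex_word: "\<exists>w\<in>words. deg w = s"
  using generators[of s] by (auto simp: words_def deg_def)

text \<open>Leading terms multiply: prepending a letter multiplies the leading term by a basis
  element and keeps lower terms lower. Hence any word of degree s can stand in for
  \<open>b s\<close>.\<close>

lemma word_triangular: "\<exists>c. c \<noteq> 0 \<and> word w - scale c (b (deg w)) \<in> lower (deg w)"
proof (induction w)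
  case Nil
  obtain c where c: "c \<noteq> 0" "b 0 = scale c 1" by (rule b_zero)
  then show ?case
    by (intro exI[of _ "inverse c"]) (simp add: word_def deg_def subspace_0 subspace_lower)
next
  case (Cons i w)
  let ?s = "g i + deg w"
  obtain c where c: "c \<noteq> 0" "word w - scale c (b (deg w)) \<in> lower (deg w)"
    using Cons.IH by blast
  obtain c' where c': "c' \<noteq> 0" "b (g i) * b (deg w) - scale c' (b ?s) \<in> lower ?s"
    using b_mult by blast
  have "b (g i) * (word w - scale c (b (deg w))) \<in> lower ?s"
    using b_mult_lower[OF c(2)] by blast
  moreover have "scale c (b (g i) * b (deg w) - scale c' (b ?s)) \<in> lower ?s"
    using c'(2) by (rule subspace_scale[OF subspace_lower])
  ultimately have "b (g i) * (word w - scale c (b (deg w)))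
      + scale c (b (g i) * b (deg w) - scale c' (b ?s)) \<in> lower ?s"
    by (rule subspace_add[OF subspace_lower])
  also have "b (g i) * (word w - scale c (b (deg w)))
      + scale c (b (g i) * b (deg w) - scale c' (b ?s)) = word (i # w) - scale (c * c') (b ?s)"
    by (simp add: word_def right_diff_distrib mult_scale_right scale_right_diff_distrib)
  finally show ?case
    using c(1) c'(1) by (intro exI[of _ "c * c'"]) (simp add: deg_def)
qed

text \<open>Triangularity is inverted by well-founded induction: any word of degree s is a nonzero
  multiple of \<open>b s\<close> up to terms that are already spanned by words of smaller
  degree.\<close>

lemma b_in_span_words: "b s \<in> span (word ` {w \<in> words. \<iota> (deg w) \<le> \<iota> s})"
  using wf_\<iota>
proof (induction s rule: wf_induct_rule)
  case (less s)
  let ?W = "span (word ` {w \<in> words. \<iota> (deg w) \<le> \<iota> s})"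
  have low: "lower s \<subseteq> ?W"
    unfolding lower_def
  proof (rule span_minimal)
    show "b ` {u. \<iota> u < \<iota> s} \<subseteq> ?W"
    proof
      fix x assume "x \<in> b ` {u. \<iota> u < \<iota> s}"
      then obtain u where u: "\<iota> u < \<iota> s" "x = b u" by blast
      have "span (word ` {w \<in> words. \<iota> (deg w) \<le> \<iota> u}) \<subseteq> ?W"
        using u(1) by (intro span_mono) auto
      then show "x \<in> ?W" using less.IH[of u] u by auto
    qed
  qed simp
  obtain w where w: "w \<in> words" "deg w = s" using ex_word by blast
  obtain c where c: "c \<noteq> 0" "word w - scale c (b s) \<in> lower s"
    using word_triangular[of w] w by auto
  have "word w \<in> ?W" using w by (intro span_base) auto
  then have "scale c (b s) \<in> ?W"
    using span_diff[of "word w" _ "word w - scale c (b s)"] c(2) low by auto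
  then have "scale (inverse c) (scale c (b s)) \<in> ?W" by (rule span_scale)
  then show ?case using c(1) by simp
qed

lemma lower_subset_span_words: "lower s \<subseteq> span (word ` {w \<in> words. \<iota> (deg w) < \<iota> s})"
  unfolding lower_def
proof (rule span_minimal)
  show "b ` {u. \<iota> u < \<iota> s} \<subseteq> span (word ` {w \<in> words. \<iota> (deg w) < \<iota> s})"
  proof
    fix x assume "x \<in> b ` {u. \<iota> u < \<iota> s}"
    then obtain u where u: "\<iota> u < \<iota> s" "x = b u" by blast
    have "span (word ` {w \<in> words. \<iota> (deg w) \<le> \<iota> u}) \<subseteq> span (word ` {w \<in> words. \<iota> (deg w) < \<iota> s})"
      using u(1) by (intro span_mono) auto
    then show "x \<in> span (word ` {w \<in> words. \<iota> (deg w) < \<iota> s})"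
      using b_in_span_words[of u] u by auto
  qed
qed simp

text \<open>Both words have a nonzero multiple of the same \<open>b (deg w)\<close> as leading term,
  and cancelling it leaves lower terms. Their support is finite, so a single relation imposes
  finitely many inequalities on a weight.\<close>

lemma word_relation:
  assumes "deg w = deg w'"
  shows "\<exists>c d. c \<noteq> 0 \<and> Poly_Mapping.keys d \<subseteq> {u \<in> words. \<iota> (deg u) < \<iota> (deg w)} \<and>
    word w - scale c (word w') = comb word d"
proof -
  obtain c where c: "c \<noteq> 0" "word w - scale c (b (deg w)) \<in> lower (deg w)"
    using word_triangular by blast
  obtain c' where c': "c' \<noteq> 0" "word w' - scale c' (b (deg w)) \<in> lower (deg w)"
    using word_triangular[of w'] assms by auto
  have "(word w - scale c (b (deg w))) - scale (c / c') (word w' - scale c' (b (deg w))) \<in> lower (deg w)"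
    by (rule subspace_diff[OF subspace_lower c(2) subspace_scale[OF subspace_lower c'(2)]])
  also have "(word w - scale c (b (deg w))) - scale (c / c') (word w' - scale c' (b (deg w)))
      = word w - scale (c / c') (word w')"
    using c'(1) by (simp add: scale_right_diff_distrib)
  finally have "word w - scale (c / c') (word w') \<in> span (word ` {u \<in> words. \<iota> (deg u) < \<iota> (deg w)})"
    using lower_subset_span_words by blast
  then obtain d where "Poly_Mapping.keys d \<subseteq> {u \<in> words. \<iota> (deg u) < \<iota> (deg w)}"
    "word w - scale (c / c') (word w') = comb word d"
    by (rule span_image_comb)
  then show ?thesis using c(1) c'(1) by (intro exI[of _ "c / c'"] exI[of _ d]) auto
qed

text \<open>
  Every congruence on a free commutative monoid of finite rank is finitely generated (Redei): the
  multisets that are not minimal in their fibre form an ideal, which has a finite basis by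
  Dickson's lemma. Rewriting its members to smaller ones, together with the commutations, connects
  all words of the same degree.
\<close>

definition nonminimal :: "nat multiset set" where
  "nonminimal = {X. set_mset X \<subseteq> {..<n} \<and> (\<exists>Y. set_mset Y \<subseteq> {..<n} \<and> Y < X \<and>
     sum_mset (image_mset g Y) = sum_mset (image_mset g X))}"

lemma deg_mset: "deg w = sum_mset (image_mset g (mset w))"
  by (simp add: deg_def sum_mset_sum_list[symmetric])

lemma finite_rewriting_system:
  obtains R where "finite R" "\<And>w w'. (w, w') \<in> R \<Longrightarrow> w \<in> words \<and> w' \<in> words \<and> deg w = deg w'"
    "\<And>i j. i < n \<Longrightarrow> j < n \<Longrightarrow> ([i, j], [j, i]) \<in> R"
    "\<And>X. X \<in> nonminimal \<Longrightarrow> \<exists>(w, w')\<in>R. mset w \<subseteq># X \<and> mset w' < mset w"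
proof -
  obtain V where V: "finite V" "V \<subseteq> nonminimal" "\<And>X. X \<in> nonminimal \<Longrightarrow> \<exists>Y\<in>V. Y \<subseteq># X"
    by (rule dickson_multiset_finite_basis[of "{..<n}" nonminimal])
      (simp_all add: nonminimal_def)
  have "\<forall>X\<in>V. \<exists>Y. set_mset Y \<subseteq> {..<n} \<and> Y < X \<and>
     sum_mset (image_mset g Y) = sum_mset (image_mset g X)"
    using V(2) by (auto simp: nonminimal_def)
  then obtain f where f: "\<And>X. X \<in> V \<Longrightarrow> set_mset (f X) \<subseteq> {..<n} \<and> f X < X \<and>
     sum_mset (image_mset g (f X)) = sum_mset (image_mset g X)" by metis
  \<comment> \<open>Algebra elements depend on the order of letters, so the commutations are rules
    as well. Given them, any listing of the two multisets would do; the sorted one is a convenient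
    choice.\<close>
  define R where "R = (\<lambda>(i, j). ([i, j], [j, i])) ` ({..<n} \<times> {..<n}) \<union>
    (\<lambda>X. (sorted_list_of_multiset X, sorted_list_of_multiset (f X))) ` V"
  show ?thesis
  proof (rule that[of R])
    show "finite R" using V(1) by (simp add: R_def)
    show "w \<in> words \<and> w' \<in> words \<and> deg w = deg w'" if "(w, w') \<in> R" for w w'
      using that f subsetD[OF V(2)]
      by (fastforce simp: R_def words_def deg_mset nonminimal_def add_mset_commute)
    show "([i, j], [j, i]) \<in> R" if "i < n" "j < n" for i j
      using that by (auto simp: R_def)
    show "\<exists>(w, w')\<in>R. mset w \<subseteq># X \<and> mset w' < mset w" if X: "X \<in> nonminimal" for X
    proof -
      obtain Y where Y: "Y \<in> V" "Y \<subseteq># X" using V(3) X by blast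
      then have "(sorted_list_of_multiset Y, sorted_list_of_multiset (f Y)) \<in> R"
        by (simp add: R_def)
      then show ?thesis using Y f[OF Y(1)] by force
    qed
  qed
qed

end

section \<open>Rewriting words modulo smaller weight\<close>

locale weighted_rewriting = generated_semigroup_basis scale l D t \<iota> b n g
  for scale :: "'k::field \<Rightarrow> 'a::ring_1 \<Rightarrow> 'a" and l D t
    and \<iota> :: "'s::comm_monoid_add \<Rightarrow> (nat \<Rightarrow>\<^sub>0 nat)" and b n g +
  fixes R :: "(nat list \<times> nat list) set" and \<phi> :: "'s \<Rightarrow> nat"
  assumes R_words: "(w, w') \<in> R \<Longrightarrow> w \<in> words \<and> w' \<in> words \<and> deg w = deg w'"
    and R_comm: "i < n \<Longrightarrow> j < n \<Longrightarrow> ([i, j], [j, i]) \<in> R"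
    and R_nonminimal: "X \<in> nonminimal \<Longrightarrow> \<exists>(w, w')\<in>R. mset w \<subseteq># X \<and> mset w' < mset w"
    and \<phi>_add: "\<phi> (s + s') = \<phi> s + \<phi> s'"
    and \<phi>_eq_0: "\<phi> s = 0 \<Longrightarrow> s = 0"
    and \<phi>_finite: "finite {s. \<phi> s \<le> m}"
    and R_weight: "(w, w') \<in> R \<Longrightarrow> \<exists>c. c \<noteq> 0 \<and>
      word w - scale c (word w') \<in> span (word ` {u \<in> words. \<phi> (deg u) < \<phi> (deg w)})"
begin

definition filt :: "nat \<Rightarrow> 'a set" where
  "filt m = span (word ` {u \<in> words. \<phi> (deg u) < m})"

lemma subspace_filt: "subspace (filt m)"
  by (simp add: filt_def)

text \<open>Concatenation adds weights exactly, so multiplying by words on either side shifts the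
  bound by exactly their weights. This makes relations modulo smaller weight stable in
  context.\<close>

lemma filt_context:
  assumes "x \<in> filt m" "u \<in> words" "v \<in> words"
  shows "word u * x * word v \<in> filt (\<phi> (deg u) + m + \<phi> (deg v))"
proof -
  have "word u * x \<in> filt (\<phi> (deg u) + m)"
    unfolding filt_def using assms(1)[unfolded filt_def]
    by (rule span_mult_closed[of "word u" "{word u}", rotated])
      (use assms(2) in \<open>auto simp: span_base word_append[symmetric] words_append deg_append \<phi>_add intro!: span_base imageI\<close>)
  then show ?thesis
    unfolding filt_def
    by (rule span_mult_closed[of _ _ "word v" "{word v}"])
      (use assms(3) in \<open>auto simp: span_base word_append[symmetric] words_append deg_append \<phi>_add intro!: span_base imageI\<close>)
qed

text \<open>The symbols of the two words agree up to a scalar in the graded ring of the weight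
  filtration. As the scalar is nonzero the relation is symmetric; the aim is that it identifies all
  words of equal degree.\<close>

definition eqv :: "nat list \<Rightarrow> nat list \<Rightarrow> bool" where
  "eqv w w' \<longleftrightarrow> deg w = deg w' \<and> (\<exists>c. c \<noteq> 0 \<and> word w - scale c (word w') \<in> filt (\<phi> (deg w)))"

lemma eqv_refl: "eqv w w"
  by (auto simp: eqv_def subspace_0 subspace_filt intro!: exI[of _ 1])

lemma eqv_sym:
  assumes "eqv w w'"
  shows "eqv w' w"
proof -
  obtain c where c: "c \<noteq> 0" "word w - scale c (word w') \<in> filt (\<phi> (deg w))" "deg w = deg w'"
    using assms by (auto simp: eqv_def)
  have "scale (- inverse c) (word w - scale c (word w')) \<in> filt (\<phi> (deg w))"
    using c(2) by (rule subspace_scale[OF subspace_filt])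
  moreover have "scale (- inverse c) (word w - scale c (word w')) = word w' - scale (inverse c) (word w)"
    using c(1) by (simp add: scale_right_diff_distrib)
  ultimately show ?thesis
    using c unfolding eqv_def by (metis nonzero_imp_inverse_nonzero)
qed

lemma eqv_trans:
  assumes "eqv w w'" "eqv w' w''"
  shows "eqv w w''"
proof -
  obtain c where c: "c \<noteq> 0" "word w - scale c (word w') \<in> filt (\<phi> (deg w))" "deg w = deg w'"
    using assms by (auto simp: eqv_def)
  obtain c' where c': "c' \<noteq> 0" "word w' - scale c' (word w'') \<in> filt (\<phi> (deg w))" "deg w = deg w''"
    using assms by (auto simp: eqv_def)
  have "word w - scale c (word w') + scale c (word w' - scale c' (word w'')) \<in> filt (\<phi> (deg w))"
    by (rule subspace_add[OF subspace_filt c(2) subspace_scale[OF subspace_filt c'(2)]])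
  then have "word w - scale (c * c') (word w'') \<in> filt (\<phi> (deg w))"
    by (simp add: scale_right_diff_distrib)
  then show ?thesis
    using c c' unfolding eqv_def by (metis mult_eq_0_iff)
qed

lemma eqv_context:
  assumes "eqv w w'" "u \<in> words" "v \<in> words"
  shows "eqv (u @ w @ v) (u @ w' @ v)"
proof -
  obtain c where c: "c \<noteq> 0" "word w - scale c (word w') \<in> filt (\<phi> (deg w))" "deg w = deg w'"
    using assms by (auto simp: eqv_def)
  have "word u * (word w - scale c (word w')) * word v \<in> filt (\<phi> (deg u) + \<phi> (deg w) + \<phi> (deg v))"
    using filt_context c(2) assms(2,3) by blast
  then have "word (u @ w @ v) - scale c (word (u @ w' @ v)) \<in> filt (\<phi> (deg (u @ w @ v)))"
    by (simp add: word_append deg_append \<phi>_add algebra_simps mult_scale_left mult_scale_right)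
  then show ?thesis
    using c by (auto simp: eqv_def deg_append)
qed

lemma eqv_R: "(w, w') \<in> R \<Longrightarrow> eqv w w'"
  using R_words R_weight by (simp add: eqv_def filt_def)

lemma eqv_move:
  assumes "i < n" "w \<in> words"
  shows "eqv (w @ [i]) (i # w)"
  using assms(2)
proof (induction w)
  case (Cons j w)
  then have w: "w \<in> words" "[j] \<in> words" "j < n" "[] \<in> words" by (auto simp: words_def)
  have "eqv ([j] @ (w @ [i]) @ []) ([j] @ (i # w) @ [])"
    using Cons w by (intro eqv_context) auto
  moreover have "eqv ([] @ [j, i] @ w) ([] @ [i, j] @ w)"
    using w assms(1) by (intro eqv_context eqv_R R_comm)
  ultimately show ?case using eqv_trans by simp
qed (simp add: eqv_refl)

text \<open>The first letter of \<open>w\<close> is located in \<open>w'\<close> and moved to the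
  front by adjacent commutations; the rest is induction.\<close>

lemma eqv_mset:
  assumes "mset w = mset w'" "w \<in> words"
  shows "eqv w w'"
  using assms
proof (induction w arbitrary: w')
  case Nil
  then show ?case by (simp add: eqv_refl)
next
  case (Cons i w)
  have "i \<in> set w'" using Cons.prems(1) by (metis list.set_intros(1) set_mset_mset)
  then obtain u v where w': "w' = u @ i # v" by (auto simp: in_set_conv_decomp)
  have "set w' = set (i # w)" using Cons.prems(1) by (metis set_mset_mset)
  then have ws: "i < n" "w \<in> words" "u \<in> words" "v \<in> words" "[] \<in> words" "[i] \<in> words"
    using Cons.prems(2) w' by (auto simp: words_def)
  have "eqv w (u @ v)" using Cons.IH[of "u @ v"] Cons.prems w' ws by simp
  then have "eqv ([i] @ w @ []) ([i] @ (u @ v) @ [])" using ws by (intro eqv_context)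
  then have "eqv (i # w) (i # u @ v)" by simp
  moreover have "eqv ([] @ (u @ [i]) @ v) ([] @ (i # u) @ v)"
    using ws by (intro eqv_context eqv_move)
  then have "eqv (i # u @ v) w'" using w' by (intro eqv_sym[of w']) simp
  ultimately show ?case by (rule eqv_trans)
qed

text \<open>Rewriting terminates because every rule applied lowers the multiset of letters, and the
  multiset order over the naturals is well-founded.\<close>

lemma eqv_minimal:
  assumes "w \<in> words"
  shows "\<exists>w'\<in>words. eqv w w' \<and> mset w' \<notin> nonminimal"
  using assms
proof (induction "mset w" arbitrary: w rule: less_induct)
  case less
  show ?case
  proof (cases "mset w \<in> nonminimal")
    case False
    then show ?thesis using less.prems eqv_refl by blast
  next
    case True
    obtain u u' where u: "(u, u') \<in> R" "mset u \<subseteq># mset w" "mset u' < mset u"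
      using R_nonminimal[OF True] by blast
    \<comment> \<open>A rule applies to a contiguous factor, so the letters of its left side are
      first collected in front; \<open>v\<close> lists the remaining ones. Adding them to both sides
      preserves the strict multiset inequality.\<close>
    define v where "v = sorted_list_of_multiset (mset w - mset u)"
    have mw: "mset (u @ v) = mset w" using u(2) by (simp add: v_def)
    have "set v \<subseteq> set w" unfolding v_def by (auto dest: in_diffD)
    then have v: "v \<in> words" "[] \<in> words" using less.prems by (auto simp: words_def)
    have "eqv w (u @ v)" using eqv_mset mw less.prems by simp
    moreover have "eqv ([] @ u @ v) ([] @ u' @ v)"
      using v u(1) by (intro eqv_context eqv_R)
    ultimately have "eqv w (u' @ v)" using eqv_trans by simp
    moreover have "mset (u' @ v) < mset w" unfolding mw[symmetric] using u(3) by simp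
    moreover have "u' @ v \<in> words" using R_words[OF u(1)] v by (simp add: words_append)
    ultimately show ?thesis using less.hyps eqv_trans by blast
  qed
qed

text \<open>Both words reduce to minimal multisets of the same fibre of the degree map. The multiset
  order is total, so these minimal multisets coincide, and the two words reached are rearrangements
  of each other.\<close>

lemma eqv_if_deg_eq:
  assumes "w \<in> words" "w' \<in> words" "deg w = deg w'"
  shows "eqv w w'"
proof -
  obtain u where u: "u \<in> words" "eqv w u" "mset u \<notin> nonminimal" using eqv_minimal assms(1) by blast
  obtain u' where u': "u' \<in> words" "eqv w' u'" "mset u' \<notin> nonminimal" using eqv_minimal assms(2) by blast
  have "deg u = deg u'" using u(2) u'(2) assms(3) by (simp add: eqv_def)
  then have "mset u = mset u'"
    using u(1,3) u'(1,3) unfolding nonminimal_def words_def deg_mset mem_Collect_eq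
    by (metis linorder_cases set_mset_mset)
  then show ?thesis using u u' eqv_mset eqv_trans eqv_sym by blast
qed

section \<open>The basis of chosen words\<close>

definition repr :: "'s \<Rightarrow> nat list" where
  "repr s = (SOME w. w \<in> words \<and> deg w = s)"

lemma repr: "repr s \<in> words" "deg (repr s) = s"
  using someI_ex[of "\<lambda>w. w \<in> words \<and> deg w = s"] ex_word[of s] by (auto simp: repr_def)

definition rebasis :: "'s \<Rightarrow> 'a" where
  "rebasis s = word (repr s)"

text \<open>A word is a multiple of the chosen word of its degree up to words of smaller weight, so
  induction on the weight suffices.\<close>

lemma filt_subset_span_rebasis: "filt m \<subseteq> span (rebasis ` {s. \<phi> s < m})"
proof (induction m rule: less_induct)
  case (less m)
  show ?case
    unfolding filt_def
  proof (rule span_minimal)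
    show "word ` {u \<in> words. \<phi> (deg u) < m} \<subseteq> span (rebasis ` {s. \<phi> s < m})"
    proof
      fix x assume "x \<in> word ` {u \<in> words. \<phi> (deg u) < m}"
      then obtain u where u: "u \<in> words" "\<phi> (deg u) < m" "x = word u" by blast
      have "eqv u (repr (deg u))" using u repr by (intro eqv_if_deg_eq) auto
      then obtain c where c: "x - scale c (rebasis (deg u)) \<in> filt (\<phi> (deg u))"
        using u(3) by (auto simp: eqv_def rebasis_def)
      have "span (rebasis ` {s. \<phi> s < \<phi> (deg u)}) \<subseteq> span (rebasis ` {s. \<phi> s < m})"
        using u(2) by (intro span_mono) auto
      then have "x - scale c (rebasis (deg u)) \<in> span (rebasis ` {s. \<phi> s < m})"
        using c less.IH[OF u(2)] by blast
      moreover have "scale c (rebasis (deg u)) \<in> span (rebasis ` {s. \<phi> s < m})"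
        using u(2) by (intro span_scale span_base) auto
      ultimately show "x \<in> span (rebasis ` {s. \<phi> s < m})"
        using span_add by fastforce
    qed
  qed simp
qed

lemma rebasis_span: "span (range rebasis) = UNIV"
proof -
  have "range b \<subseteq> span (range rebasis)"
  proof
    fix x assume "x \<in> range b"
    then obtain s where "x \<in> span (word ` {w \<in> words. \<iota> (deg w) \<le> \<iota> s})"
      using b_in_span_words by blast
    moreover have "word ` {w \<in> words. \<iota> (deg w) \<le> \<iota> s} \<subseteq> span (range rebasis)"
    proof
      fix y assume "y \<in> word ` {w \<in> words. \<iota> (deg w) \<le> \<iota> s}"
      then obtain w where "w \<in> words" "y = word w" by blast
      then have "y \<in> filt (Suc (\<phi> (deg w)))" unfolding filt_def by (intro span_base) auto
      then show "y \<in> span (range rebasis)"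
        using filt_subset_span_rebasis span_mono[of "rebasis ` _" "range rebasis"] by blast
    qed
    ultimately show "x \<in> span (range rebasis)"
      using span_minimal[OF _ subspace_span] by blast
  qed
  then show ?thesis using span_minimal[OF _ subspace_span] b_span by blast
qed

text \<open>Independence comes from the original basis through the lexicographic order: every chosen
  word has leading term \<open>b s\<close>, and the largest index occurring in a relation
  contributes a leading term that nothing cancels.\<close>

lemma comb_rebasis_eq_0:
  assumes "comb rebasis d = 0"
  shows "d = 0"
proof (rule ccontr)
  assume "d \<noteq> 0"
  let ?K = "Poly_Mapping.keys d"
  have K: "finite (\<iota> ` ?K)" "\<iota> ` ?K \<noteq> {}" using \<open>d \<noteq> 0\<close> by auto
  obtain s where s: "s \<in> ?K" "\<iota> s = Max (\<iota> ` ?K)" using Max_in[OF K] by auto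
  have lt: "\<iota> u < \<iota> s" if "u \<in> ?K - {s}" for u
    using that s(2) Max_ge[OF K(1), of "\<iota> u"] \<iota>_inj by (metis Diff_iff imageI injD insertI1 order_le_less)
  have tri: "\<exists>c. c \<noteq> 0 \<and> rebasis u - scale c (b u) \<in> lower u" for u
    using word_triangular[of "repr u"] repr by (simp add: rebasis_def)
  have "rebasis u \<in> lower s" if "u \<in> ?K - {s}" for u
  proof -
    obtain c where "rebasis u - scale c (b u) \<in> lower u" using tri by blast
    then have "rebasis u - scale c (b u) \<in> lower s" using lower_mono[of u s] lt[OF that]
      by (meson less_imp_le subsetD)
    moreover have "scale c (b u) \<in> lower s"
      using lt[OF that] by (intro subspace_scale[OF subspace_lower] b_in_lower)
    ultimately show ?thesis using subspace_add[OF subspace_lower] by fastforce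
  qed
  then have rest: "(\<Sum>u\<in>?K - {s}. scale (Poly_Mapping.lookup d u) (rebasis u)) \<in> lower s"
    by (intro subspace_sum[OF subspace_lower] subspace_scale[OF subspace_lower])
  have "scale (Poly_Mapping.lookup d s) (rebasis s)
      + (\<Sum>u\<in>?K - {s}. scale (Poly_Mapping.lookup d u) (rebasis u)) = 0"
    using assms s(1) unfolding comb_def by (subst (asm) sum.remove) auto
  then have "scale (Poly_Mapping.lookup d s) (rebasis s) \<in> lower s"
    using subspace_neg[OF subspace_lower rest] by (metis eq_neg_iff_add_eq_0)
  then have "scale (inverse (Poly_Mapping.lookup d s)) (scale (Poly_Mapping.lookup d s) (rebasis s))
      \<in> lower s"
    by (rule subspace_scale[OF subspace_lower])
  then have rs: "rebasis s \<in> lower s" using s(1) by (simp add: in_keys_iff)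
  obtain c where c: "c \<noteq> 0" "rebasis s - scale c (b s) \<in> lower s" using tri by blast
  have "rebasis s - (rebasis s - scale c (b s)) \<in> lower s"
    using rs c(2) by (rule subspace_diff[OF subspace_lower])
  then have "scale c (b s) \<in> lower s" by simp
  then have "scale (inverse c) (scale c (b s)) \<in> lower s"
    by (rule subspace_scale[OF subspace_lower])
  then show False using c(1) b_notin_lower by simp
qed

lemma word_homogeneous: "\<exists>v\<in>NN l. word w \<in> D v"
proof (induction w)
  case Nil
  show ?case using one_in_D0 NN_zero by (auto simp: word_def)
next
  case (Cons i w)
  then obtain v where v: "v \<in> NN l" "word w \<in> D v" by blast
  obtain u where "u \<in> NN l" "b (g i) \<in> D u" using b_homogeneous by blast
  then have "word (i # w) \<in> D (u + v)" "u + v \<in> NN l"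
    using v component_mult NN_add by (auto simp: word_def)
  then show ?case by blast
qed

lemma weighted_basis_rebasis: "weighted_basis \<phi> rebasis"
  unfolding weighted_basis_def
proof (intro conjI allI)
  fix s s'
  \<comment> \<open>The product of two chosen words is itself a word, of degree s + s', hence
    comparable with the chosen word of that degree.\<close>
  have "eqv (repr s @ repr s') (repr (s + s'))"
    using repr by (intro eqv_if_deg_eq) (auto simp: words_append deg_append)
  then show "\<exists>c. c \<noteq> 0 \<and> rebasis s * rebasis s' - scale c (rebasis (s + s'))
      \<in> span (rebasis ` {u. \<phi> u < \<phi> (s + s')})"
    using filt_subset_span_rebasis
    by (auto simp: eqv_def rebasis_def word_append deg_append repr)
  show "inj rebasis" "independent (range rebasis)"
    using independent_range_if_comb[of rebasis] comb_rebasis_eq_0 by blast+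
  show "\<exists>v\<in>NN l. rebasis s \<in> D v"
    using word_homogeneous by (simp add: rebasis_def)
qed (use \<phi>_add \<phi>_eq_0 \<phi>_finite rebasis_span in auto)

end

lemma (in generated_semigroup_basis) ex_weighted_basis:
  "\<exists>(\<phi> :: 's \<Rightarrow> nat) b'. weighted_basis \<phi> b'"
proof -
  obtain R where R: "finite R" "\<And>w w'. (w, w') \<in> R \<Longrightarrow> w \<in> words \<and> w' \<in> words \<and> deg w = deg w'"
    "\<And>i j. i < n \<Longrightarrow> j < n \<Longrightarrow> ([i, j], [j, i]) \<in> R"
    "\<And>X. X \<in> nonminimal \<Longrightarrow> \<exists>(w, w')\<in>R. mset w \<subseteq># X \<and> mset w' < mset w"
    by (rule finite_rewriting_system) blast
  have "\<forall>p\<in>R. \<exists>q. fst q \<noteq> 0 \<and>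
      Poly_Mapping.keys (snd q) \<subseteq> {u \<in> words. \<iota> (deg u) < \<iota> (deg (fst p))} \<and>
      word (fst p) - scale (fst q) (word (snd p)) = comb word (snd q)"
  proof
    fix p assume "p \<in> R"
    then have "deg (fst p) = deg (snd p)" using R(2)[of "fst p" "snd p"] by simp
    from word_relation[OF this] show "\<exists>q. fst q \<noteq> 0 \<and>
      Poly_Mapping.keys (snd q) \<subseteq> {u \<in> words. \<iota> (deg u) < \<iota> (deg (fst p))} \<and>
      word (fst p) - scale (fst q) (word (snd p)) = comb word (snd q)"
      by simp
  qed
  from bchoice[OF this] obtain q where q: "\<forall>p\<in>R. fst (q p) \<noteq> 0 \<and>
      Poly_Mapping.keys (snd (q p)) \<subseteq> {u \<in> words. \<iota> (deg u) < \<iota> (deg (fst p))} \<and>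
      word (fst p) - scale (fst (q p)) (word (snd p)) = comb word (snd (q p))" ..
  define c where "c p = fst (q p)" for p
  define d where "d p = snd (q p)" for p
  have cd: "\<And>p. p \<in> R \<Longrightarrow> c p \<noteq> 0"
    "\<And>p. p \<in> R \<Longrightarrow> Poly_Mapping.keys (d p) \<subseteq> {u \<in> words. \<iota> (deg u) < \<iota> (deg (fst p))}"
    "\<And>p. p \<in> R \<Longrightarrow> word (fst p) - scale (c p) (word (snd p)) = comb word (d p)"
    using q by (auto simp: c_def d_def)
  \<comment> \<open>One pair for each lower term of each rule: its degree against the degree of the
    left side. The rules and the supports are finite, so a single weight respects all these
    pairs.\<close>
  define P where "P = (\<Union>p\<in>R. (\<lambda>u. (deg u, deg (fst p))) ` Poly_Mapping.keys (d p))"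
  have fin: "finite P" using R(1) by (simp add: P_def)
  have lt: "\<iota> s < \<iota> s'" if "(s, s') \<in> P" for s s'
    using that cd(2) by (force simp: P_def)
  obtain \<phi> :: "'s \<Rightarrow> nat" where \<phi>: "\<And>s s'. \<phi> (s + s') = \<phi> s + \<phi> s'"
    "\<And>s. \<phi> s = 0 \<Longrightarrow> s = 0" "\<And>n. finite {s. \<phi> s \<le> n}" "\<And>s s'. (s, s') \<in> P \<Longrightarrow> \<phi> s < \<phi> s'"
    by (rule exists_weight[OF embedding fin lt]) auto
  have "\<exists>e. e \<noteq> 0 \<and> word w - scale e (word w') \<in> span (word ` {u \<in> words. \<phi> (deg u) < \<phi> (deg w)})"
    if "(w, w') \<in> R" for w w'
  proof (intro exI[of _ "c (w, w')"] conjI)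
    have "Poly_Mapping.keys (d (w, w')) \<subseteq> {u \<in> words. \<phi> (deg u) < \<phi> (deg w)}"
    proof
      fix u assume u: "u \<in> Poly_Mapping.keys (d (w, w'))"
      then have "(deg u, deg w) \<in> P" using that by (force simp: P_def)
      then show "u \<in> {u \<in> words. \<phi> (deg u) < \<phi> (deg w)}" using u cd(2)[OF that] \<phi>(4) by auto
    qed
    then show "word w - scale (c (w, w')) (word w') \<in> span (word ` {u \<in> words. \<phi> (deg u) < \<phi> (deg w)})"
      using cd(3)[OF that] comb_in_span by auto
  qed (use that cd(1) in auto)
  then interpret weighted_rewriting scale l D t \<iota> b n g R \<phi>
    using R \<phi> by unfold_locales auto
  show ?thesis using weighted_basis_rebasis by blast
qed

section \<open>The associated graded ring of a filtration\<close>

locale filtered_algebra = connected_graded_algebra scale l D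
  for scale :: "'k::field \<Rightarrow> 'a::ring_1 \<Rightarrow> 'a" and l D +
  fixes F :: "nat \<Rightarrow> 'a set"
  assumes filtration: "graded_filtration scale l D F"
begin

abbreviation gr :: "('k, nat \<Rightarrow> 'a set) module" where
  "gr \<equiv> assoc_graded scale F"

abbreviation P :: "nat \<Rightarrow> 'a set" where
  "P \<equiv> filt_pred F"

lemma F_zero: "F 0 = {scale c 1 | c. True}"
  and F_UN: "(\<Union>n. F n) = UNIV"
  and F_mult: "x \<in> F n \<Longrightarrow> y \<in> F m \<Longrightarrow> x * y \<in> F (n + m)"
  and subspace_F: "subspace (F n)"
  and F_finite_dimensional: "finite_dimensional scale (F n)"
  using filtration by (auto simp: graded_filtration_def graded_subspace_def)

lemma F_mono: "n \<le> m \<Longrightarrow> F n \<subseteq> F m"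
  using filtration lift_Suc_mono_le[of F n m] by (auto simp: graded_filtration_def)

lemma subspace_P: "subspace (P n)"
  by (cases n) (auto simp: filt_pred_def subspace_F)

lemma P_subset_F: "P n \<subseteq> F n"
  using F_mono[of "n - 1" n] subspace_0[OF subspace_F, of 0] by (cases n) (auto simp: filt_pred_def)

lemma F_subset_P: "n < m \<Longrightarrow> F n \<subseteq> P m"
  using F_mono[of n "m - 1"] by (cases m) (auto simp: filt_pred_def)

lemma P_mult_left: "x \<in> P n \<Longrightarrow> y \<in> F m \<Longrightarrow> x * y \<in> P (n + m)"
  using F_mult[of x "n - 1" y m] subspace_0[OF subspace_P] by (cases n) (auto simp: filt_pred_def)

lemma P_mult_right: "x \<in> F n \<Longrightarrow> y \<in> P m \<Longrightarrow> x * y \<in> P (n + m)"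
  using F_mult[of x n y "m - 1"] subspace_0[OF subspace_P] by (cases m) (auto simp: filt_pred_def)

text \<open>The coset sequence with representatives \<open>a\<close>, so that operations of
  \<open>gr\<close> can be computed on sequences in the algebra. It is defined for every
  \<open>a\<close>; membership in the carrier is a separate matter, see
  \<open>cls_in_carrier\<close>.\<close>

definition cls :: "(nat \<Rightarrow> 'a) \<Rightarrow> nat \<Rightarrow> 'a set" where
  "cls a n = (+) (a n) ` P n"

lemma mem_cls: "x \<in> cls a n \<longleftrightarrow> x - a n \<in> P n"
  by (force simp: cls_def image_iff algebra_simps)

lemma cls_apply_eq_iff: "cls a n = cls a' n \<longleftrightarrow> a n - a' n \<in> P n"
proof
  assume "cls a n = cls a' n"
  moreover have "a n \<in> cls a n" by (simp add: mem_cls subspace_0 subspace_P)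
  ultimately show "a n - a' n \<in> P n" by (simp add: mem_cls)
next
  assume *: "a n - a' n \<in> P n"
  show "cls a n = cls a' n"
  proof (rule Set.set_eqI)
    fix x
    have "x - a' n = (x - a n) + (a n - a' n)" "x - a n = (x - a' n) - (a n - a' n)" by auto
    then show "x \<in> cls a n \<longleftrightarrow> x \<in> cls a' n"
      unfolding mem_cls using * subspace_add[OF subspace_P] subspace_diff[OF subspace_P] by metis
  qed
qed

lemma cls_eq_iff: "cls a = cls a' \<longleftrightarrow> (\<forall>n. a n - a' n \<in> P n)"
  by (simp add: fun_eq_iff cls_apply_eq_iff)

lemma cls_apply_zero: "a n = 0 \<Longrightarrow> cls a n = P n"
  by (simp add: cls_def image_def)

lemma one_gr: "\<one>\<^bsub>gr\<^esub> = cls (\<lambda>n. if n = 0 then 1 else 0)"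
  by (auto simp: assoc_graded_def fun_eq_iff cls_def filt_pred_def)

lemma add_gr: "cls a \<oplus>\<^bsub>gr\<^esub> cls a' = cls (\<lambda>n. a n + a' n)"
proof (rule ext, rule Set.set_eqI)
  fix n x
  have "x \<in> (cls a \<oplus>\<^bsub>gr\<^esub> cls a') n \<longleftrightarrow> (\<exists>y z. x = y + z \<and> y - a n \<in> P n \<and> z - a' n \<in> P n)"
    by (simp add: assoc_graded_def mem_cls)
  also have "\<dots> \<longleftrightarrow> x - (a n + a' n) \<in> P n"
  proof
    assume "\<exists>y z. x = y + z \<and> y - a n \<in> P n \<and> z - a' n \<in> P n"
    then obtain y z where yz: "x = y + z" "y - a n \<in> P n" "z - a' n \<in> P n" by blast
    have "x - (a n + a' n) = (y - a n) + (z - a' n)" using yz(1) by simp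
    then show "x - (a n + a' n) \<in> P n" using yz subspace_add[OF subspace_P] by metis
  next
    assume "x - (a n + a' n) \<in> P n"
    then show "\<exists>y z. x = y + z \<and> y - a n \<in> P n \<and> z - a' n \<in> P n"
      by (intro exI[of _ "a n"] exI[of _ "x - a n"])
        (simp add: algebra_simps subspace_0[OF subspace_P])
  qed
  finally show "x \<in> (cls a \<oplus>\<^bsub>gr\<^esub> cls a') n \<longleftrightarrow> x \<in> cls (\<lambda>n. a n + a' n) n"
    by (simp add: mem_cls)
qed

text \<open>The summand from \<open>P n\<close> in the definition matters for c = 0, where the
  scaled coset alone would shrink to {0}.\<close>

lemma smult_gr: "c \<odot>\<^bsub>gr\<^esub> cls a = cls (\<lambda>n. scale c (a n))"
proof (rule ext, rule Set.set_eqI)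
  fix n x
  have "x \<in> (c \<odot>\<^bsub>gr\<^esub> cls a) n \<longleftrightarrow> (\<exists>y z. x = scale c y + z \<and> y - a n \<in> P n \<and> z \<in> P n)"
    by (simp add: assoc_graded_def mem_cls)
  also have "\<dots> \<longleftrightarrow> x - scale c (a n) \<in> P n"
  proof
    assume "\<exists>y z. x = scale c y + z \<and> y - a n \<in> P n \<and> z \<in> P n"
    then obtain y z where yz: "x = scale c y + z" "y - a n \<in> P n" "z \<in> P n" by blast
    have "x - scale c (a n) = scale c (y - a n) + z"
      using yz(1) by (simp add: scale_right_diff_distrib)
    then show "x - scale c (a n) \<in> P n"
      using yz subspace_add[OF subspace_P] subspace_scale[OF subspace_P] by metis
  next
    assume "x - scale c (a n) \<in> P n"
    then show "\<exists>y z. x = scale c y + z \<and> y - a n \<in> P n \<and> z \<in> P n"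
      by (intro exI[of _ "a n"] exI[of _ "x - scale c (a n)"])
        (simp add: subspace_0[OF subspace_P])
  qed
  finally show "x \<in> (c \<odot>\<^bsub>gr\<^esub> cls a) n \<longleftrightarrow> x \<in> cls (\<lambda>n. scale c (a n)) n"
    by (simp add: mem_cls)
qed

lemma mult_gr:
  assumes a: "\<And>n. a n \<in> F n" and a': "\<And>n. a' n \<in> F n"
  shows "cls a \<otimes>\<^bsub>gr\<^esub> cls a' = cls (\<lambda>n. \<Sum>i\<le>n. a i * a' (n - i))"
proof (rule ext, rule Set.set_eqI)
  fix n x
  let ?c = "\<Sum>i\<le>n. a i * a' (n - i)"
  have "x \<in> (cls a \<otimes>\<^bsub>gr\<^esub> cls a') n \<longleftrightarrow> (\<exists>y z f. x = (\<Sum>i\<le>n. y i * z (n - i)) + f \<and>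
      (\<forall>i\<le>n. y i - a i \<in> P i) \<and> (\<forall>i\<le>n. z i - a' i \<in> P i) \<and> f \<in> P n)"
    by (simp add: assoc_graded_def mem_cls)
  also have "\<dots> \<longleftrightarrow> x - ?c \<in> P n"
  proof
    assume "\<exists>y z f. x = (\<Sum>i\<le>n. y i * z (n - i)) + f \<and>
      (\<forall>i\<le>n. y i - a i \<in> P i) \<and> (\<forall>i\<le>n. z i - a' i \<in> P i) \<and> f \<in> P n"
    then obtain y z f where x: "x = (\<Sum>i\<le>n. y i * z (n - i)) + f"
      and y: "\<And>i. i \<le> n \<Longrightarrow> y i - a i \<in> P i" and z: "\<And>i. i \<le> n \<Longrightarrow> z i - a' i \<in> P i"
      and f: "f \<in> P n" by blast
    \<comment> \<open>Independence of representatives: the difference is (y - a) z + a (z - a'), and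
      in each product one factor drops a filtration step.\<close>
    have "y i * z (n - i) - a i * a' (n - i) \<in> P n" if "i \<le> n" for i
    proof -
      have "(z (n - i) - a' (n - i)) + a' (n - i) \<in> F (n - i)"
        using z[of "n - i"] P_subset_F a' subspace_add[OF subspace_F] by (meson diff_le_self subsetD)
      then have "(y i - a i) * z (n - i) \<in> P (i + (n - i))"
        using y[OF that] by (intro P_mult_left) auto
      moreover have "a i * (z (n - i) - a' (n - i)) \<in> P (i + (n - i))"
        using z[of "n - i"] a by (intro P_mult_right) auto
      ultimately have "(y i - a i) * z (n - i) + a i * (z (n - i) - a' (n - i)) \<in> P n"
        using that subspace_add[OF subspace_P] by simp
      then show ?thesis by (simp add: algebra_simps)
    qed
    then have "(\<Sum>i\<le>n. y i * z (n - i) - a i * a' (n - i)) + f \<in> P n"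
      using f by (intro subspace_add[OF subspace_P] subspace_sum[OF subspace_P]) auto
    then show "x - ?c \<in> P n" by (simp add: x sum_subtractf algebra_simps)
  next
    assume "x - ?c \<in> P n"
    then show "\<exists>y z f. x = (\<Sum>i\<le>n. y i * z (n - i)) + f \<and>
      (\<forall>i\<le>n. y i - a i \<in> P i) \<and> (\<forall>i\<le>n. z i - a' i \<in> P i) \<and> f \<in> P n"
      by (intro exI[of _ a] exI[of _ a'] exI[of _ "x - ?c"])
        (simp add: subspace_0[OF subspace_P])
  qed
  finally show "x \<in> (cls a \<otimes>\<^bsub>gr\<^esub> cls a') n \<longleftrightarrow> x \<in> cls (\<lambda>n. \<Sum>i\<le>n. a i * a' (n - i)) n"
    by (simp add: mem_cls)
qed

lemma cls_in_carrier:
  assumes "\<And>n. a n \<in> F n" "finite {n. a n \<notin> P n}"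
  shows "cls a \<in> carrier gr"
proof -
  have "{n. cls a n \<noteq> P n} \<subseteq> {n. a n \<notin> P n}"
    using cls_apply_eq_iff[of a _ "\<lambda>_. 0"] cls_apply_zero[of "\<lambda>_. 0"] by auto
  then show ?thesis
    using assms finite_subset by (auto simp: assoc_graded_def cls_def)
qed

lemma carrier_grE:
  assumes "x \<in> carrier gr"
  obtains a where "x = cls a" "\<And>n. a n \<in> F n" "finite {n. a n \<noteq> 0}"
proof -
  have x: "\<forall>n. \<exists>a\<in>F n. x n = (+) a ` P n" "finite {n. x n \<noteq> P n}"
    using assms by (auto simp: assoc_graded_def)
  then obtain a where a: "\<And>n. a n \<in> F n" "\<And>n. x n = (+) (a n) ` P n" by metis
  \<comment> \<open>Choosing 0 as representative of every zero coset gives a finitely supported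
    sequence of representatives, over which sums can be formed.\<close>
  define a' where "a' n = (if x n = P n then 0 else a n)" for n
  have "x = cls a'"
    using a by (auto simp: fun_eq_iff a'_def cls_def)
  moreover have "a' n \<in> F n" for n using a subspace_0[OF subspace_F] by (simp add: a'_def)
  moreover have "finite {n. a' n \<noteq> 0}"
    by (rule finite_subset[OF _ x(2)]) (auto simp: a'_def)
  ultimately show ?thesis using that by blast
qed

end

section \<open>From a weighted basis to a degeneration\<close>

locale weighted_basis_algebra = connected_graded_algebra scale l D
  for scale :: "'k::field \<Rightarrow> 'a::ring_1 \<Rightarrow> 'a" and l D +
  fixes \<phi> :: "'s::comm_monoid_add \<Rightarrow> nat" and b :: "'s \<Rightarrow> 'a"
  assumes wb: "weighted_basis \<phi> b"
begin

lemma \<phi>_add: "\<phi> (s + s') = \<phi> s + \<phi> s'"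
  and \<phi>_eq_0: "\<phi> s = 0 \<Longrightarrow> s = 0"
  and \<phi>_finite: "finite {s. \<phi> s \<le> n}"
  and b_inj: "inj b"
  and b_independent: "independent (range b)"
  and b_span: "span (range b) = UNIV"
  and b_homogeneous: "\<exists>v\<in>NN l. b s \<in> D v"
  and b_mult: "\<exists>c. c \<noteq> 0 \<and> b s * b s' - scale c (b (s + s')) \<in> span (b ` {u. \<phi> u < \<phi> (s + s')})"
  using wb by (auto simp: weighted_basis_def)

lemma \<phi>_zero: "\<phi> 0 = 0"
  using \<phi>_add[of 0 0] by simp

definition F :: "nat \<Rightarrow> 'a set" where
  "F n = span (b ` {s. \<phi> s \<le> n})"

lemma filt_pred_F: "filt_pred F n = span (b ` {s. \<phi> s < n})"
  by (cases n) (auto simp: filt_pred_def F_def less_Suc_eq_le)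

text \<open>Independence makes coefficients unique, so the filtration level can be read off from the
  support.\<close>

lemma comb_mem_filt_pred_iff:
  "comb b d \<in> filt_pred F n \<longleftrightarrow> (\<forall>s\<in>Poly_Mapping.keys d. \<phi> s < n)"
proof
  assume "comb b d \<in> filt_pred F n"
  then obtain e where e: "Poly_Mapping.keys e \<subseteq> {s. \<phi> s < n}" "comb b d = comb b e"
    unfolding filt_pred_F by (rule span_image_comb)
  have "comb b d = comb b (d - e) + comb b e" by (simp add: comb_add[symmetric])
  then have "comb b (d - e) = 0" using e(2) by simp
  then have "d = e" using comb_eq_0_iff[OF b_inj b_independent] by simp
  then show "\<forall>s\<in>Poly_Mapping.keys d. \<phi> s < n" using e by auto
qed (auto simp: filt_pred_F intro: comb_in_span)

lemma b_notin_filt_pred: "b s \<notin> filt_pred F (\<phi> s)"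
  using comb_mem_filt_pred_iff[of "Poly_Mapping.single s 1" "\<phi> s"] by simp

text \<open>The value is determined: two candidates would put a nonzero multiple of
  \<open>b (s + s')\<close> into the filtration step strictly below its own.\<close>

definition \<alpha> :: "'s \<Rightarrow> 's \<Rightarrow> 'k" where
  "\<alpha> s s' = (SOME c. c \<noteq> 0 \<and> b s * b s' - scale c (b (s + s')) \<in> filt_pred F (\<phi> (s + s')))"

lemma \<alpha>_nonzero: "\<alpha> s s' \<noteq> 0"
  and \<alpha>: "b s * b s' - scale (\<alpha> s s') (b (s + s')) \<in> filt_pred F (\<phi> (s + s'))"
  using someI_ex[OF b_mult[of s s']] by (auto simp: \<alpha>_def filt_pred_F)

lemma b_in_F: "b s \<in> F (\<phi> s)"
  by (auto simp: F_def intro: span_base)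

text \<open>This matches the convention for an unnormalised cocycle, where the unit is the inverse
  of \<alpha>(0,0) times the basis element at 0.\<close>

lemma b_zero: "b 0 = scale (\<alpha> 0 0) 1"
proof -
  have eq: "b 0 * b 0 = scale (\<alpha> 0 0) (b 0)"
    using \<alpha>[of 0 0] by (simp add: \<phi>_zero filt_pred_def)
  have "b 0 \<noteq> 0" using b_notin_filt_pred[of 0] by (auto simp: \<phi>_zero filt_pred_def)
  then obtain d where d: "d \<noteq> 0" "b 0 = scale d 1"
    using homogeneous_quasi_idempotent_scalar[OF _ _ _ eq \<alpha>_nonzero] b_homogeneous[of 0] by blast
  have "scale (d * d) 1 = scale (\<alpha> 0 0 * d) 1"
    using eq d by (simp add: mult_scale_left)
  then have "\<alpha> 0 0 = d" using d(1) by simp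
  then show ?thesis using d by simp
qed

lemma F_mult: "x \<in> F n \<Longrightarrow> y \<in> F m \<Longrightarrow> x * y \<in> F (n + m)"
  unfolding F_def
proof (rule span_mult_closed[of x "b ` {s. \<phi> s \<le> n}" y "b ` {s. \<phi> s \<le> m}"])
  fix x y assume "x \<in> b ` {s. \<phi> s \<le> n}" "y \<in> b ` {s. \<phi> s \<le> m}"
  then obtain s s' where s: "x = b s" "y = b s'" "\<phi> s + \<phi> s' \<le> n + m" by fastforce
  have "span (b ` {u. \<phi> u < \<phi> (s + s')}) \<subseteq> span (b ` {u. \<phi> u \<le> n + m})"
    using s(3) \<phi>_add by (intro span_mono) auto
  then have "x * y - scale (\<alpha> s s') (b (s + s')) \<in> span (b ` {u. \<phi> u \<le> n + m})"
    using \<alpha>[of s s'] s by (auto simp: filt_pred_F)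
  moreover have "scale (\<alpha> s s') (b (s + s')) \<in> span (b ` {u. \<phi> u \<le> n + m})"
    using s(3) \<phi>_add by (intro span_scale span_base) auto
  ultimately show "x * y \<in> span (b ` {u. \<phi> u \<le> n + m})"
    using span_add by fastforce
qed

lemma graded_filtration_F: "graded_filtration scale l D F"
  unfolding graded_filtration_def
proof (intro conjI allI ballI)
  obtain c where c: "c \<noteq> 0" "b 0 = scale c 1" using b_zero \<alpha>_nonzero by blast
  \<comment> \<open>Positivity of the weight leaves only \<open>b 0\<close>, a nonzero scalar, in
    level 0.\<close>
  have "{s. \<phi> s \<le> 0} = {0}" using \<phi>_eq_0 \<phi>_zero by auto
  then have "F 0 = range (\<lambda>k. scale (k * c) 1)"
    by (simp add: F_def span_singleton c)
  also have "\<dots> = {scale k 1 |k. True}"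
  proof (safe, goal_cases)
    case (2 _ k)
    show ?case using c(1) by (intro image_eqI[of _ _ "k / c"]) auto
  qed auto
  finally show "F 0 = {scale k 1 |k. True}" .
next
  show "F n \<subseteq> F (Suc n)" for n unfolding F_def by (intro span_mono) auto
  show "(\<Union>n. F n) = UNIV"
  proof (intro equalityI subset_UNIV subsetI)
    fix x
    obtain d where d: "x = comb b d" using span_image_comb[of x b UNIV] b_span by blast
    define n where "n = Max (insert 0 (\<phi> ` Poly_Mapping.keys d))"
    have "\<phi> s \<le> n" if "s \<in> Poly_Mapping.keys d" for s
      using that by (auto simp: n_def)
    then have "x \<in> F n" unfolding F_def d by (intro comb_in_span) auto
    then show "x \<in> (\<Union>n. F n)" by blast
  qed
  show "x * y \<in> F (n + m)" if "x \<in> F n" "y \<in> F m" for n m x y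
    using that by (rule F_mult)
  show "finite_dimensional scale (F n)" for n
    unfolding finite_dimensional_def F_def using \<phi>_finite by blast
  show "graded_subspace scale l D (F n)" for n
    unfolding graded_subspace_def
  proof (intro conjI equalityI)
    show "subspace (F n)" by (simp add: F_def)
    then show "span (\<Union>v\<in>NN l. F n \<inter> D v) \<subseteq> F n" by (intro span_minimal) auto
    have "b s \<in> (\<Union>v\<in>NN l. F n \<inter> D v)" if "\<phi> s \<le> n" for s
      using that b_homogeneous[of s] by (auto simp: F_def intro: span_base)
    then show "F n \<subseteq> span (\<Union>v\<in>NN l. F n \<inter> D v)"
      by (subst F_def) (intro span_mono, auto)
  qed
qed

sublocale filtered_algebra scale l D F
  by unfold_locales (rule graded_filtration_F)

lemma two_cocycle_\<alpha>: "two_cocycle \<alpha>"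
  unfolding two_cocycle_def
proof (intro conjI allI \<alpha>_nonzero)
  fix s s' s''
  let ?n = "\<phi> (s + s' + s'')"
  have n: "?n = \<phi> (s + s') + \<phi> s''" "?n = \<phi> s + \<phi> (s' + s'')" by (simp_all add: \<phi>_add)
  have 1: "(b s * b s' - scale (\<alpha> s s') (b (s + s'))) * b s'' \<in> P ?n"
    unfolding n(1) by (intro P_mult_left \<alpha> b_in_F)
  have 2: "b s * (b s' * b s'' - scale (\<alpha> s' s'') (b (s' + s''))) \<in> P ?n"
    unfolding n(2) by (intro P_mult_right \<alpha> b_in_F)
  have 3: "scale (\<alpha> s s') (b (s + s') * b s'' - scale (\<alpha> (s + s') s'') (b (s + s' + s''))) \<in> P ?n"
    by (intro subspace_scale[OF subspace_P] \<alpha>)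
  have 4: "scale (\<alpha> s' s'') (b s * b (s' + s'') - scale (\<alpha> s (s' + s'')) (b (s + s' + s''))) \<in> P ?n"
    using subspace_scale[OF subspace_P \<alpha>[of s "s' + s''"]] by (simp add: add.assoc)
  \<comment> \<open>Both bracketings of the triple product are expanded. The product itself cancels
    by associativity, leaving four error terms of weight below that of s + s' + s''.\<close>
  have "scale (\<alpha> s s' * \<alpha> (s + s') s'' - \<alpha> s (s' + s'') * \<alpha> s' s'') (b (s + s' + s''))
    = b s * (b s' * b s'' - scale (\<alpha> s' s'') (b (s' + s'')))
      + scale (\<alpha> s' s'') (b s * b (s' + s'') - scale (\<alpha> s (s' + s'')) (b (s + s' + s'')))
      - ((b s * b s' - scale (\<alpha> s s') (b (s + s'))) * b s''
      + scale (\<alpha> s s') (b (s + s') * b s'' - scale (\<alpha> (s + s') s'') (b (s + s' + s''))))"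
    by (simp add: algebra_simps mult_scale_left mult_scale_right scale_left_diff_distrib
        scale_right_diff_distrib)
  also have "\<dots> \<in> P ?n"
    by (intro subspace_diff[OF subspace_P] subspace_add[OF subspace_P] 1 2 3 4)
  finally have "comb b (Poly_Mapping.single (s + s' + s'')
      (\<alpha> s s' * \<alpha> (s + s') s'' - \<alpha> s (s' + s'') * \<alpha> s' s'')) \<in> P ?n" by simp
  then show "\<alpha> s s' * \<alpha> (s + s') s'' = \<alpha> s (s' + s'') * \<alpha> s' s''"
    unfolding comb_mem_filt_pred_iff by (auto split: if_splits)
qed

end

section \<open>Splitting combinations by weight\<close>

context algebra_over_field
begin

definition weight_part :: "('s \<Rightarrow> nat) \<Rightarrow> nat \<Rightarrow> ('s \<Rightarrow>\<^sub>0 'k) \<Rightarrow> ('s \<Rightarrow>\<^sub>0 'k)" where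
  "weight_part \<phi> n x = Abs_poly_mapping (\<lambda>s. if \<phi> s = n then Poly_Mapping.lookup x s else 0)"

lemma lookup_weight_part:
  "Poly_Mapping.lookup (weight_part \<phi> n x) s = (if \<phi> s = n then Poly_Mapping.lookup x s else 0)"
proof -
  have "{s. (if \<phi> s = n then Poly_Mapping.lookup x s else 0) \<noteq> 0} \<subseteq> Poly_Mapping.keys x"
    by (auto simp: in_keys_iff)
  then show ?thesis
    unfolding weight_part_def using finite_subset[OF _ finite_keys] by (subst lookup_Abs_poly_mapping) blast+
qed

lemma keys_weight_part: "Poly_Mapping.keys (weight_part \<phi> n x) = {s \<in> Poly_Mapping.keys x. \<phi> s = n}"
  by (auto simp: in_keys_iff lookup_weight_part split: if_splits)

text \<open>Zeroing members of the family instead of coefficients makes additivity and homogeneity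
  immediate from \<open>comb\<close>. Nothing is assumed about \<phi> and b, so both directions of
  the theorem can use it.\<close>

definition slice :: "('s \<Rightarrow> nat) \<Rightarrow> ('s \<Rightarrow> 'a) \<Rightarrow> ('s \<Rightarrow>\<^sub>0 'k) \<Rightarrow> nat \<Rightarrow> 'a" where
  "slice \<phi> b x n = comb (\<lambda>s. if \<phi> s = n then b s else 0) x"

lemma slice_eq_comb_weight_part: "slice \<phi> b x n = comb b (weight_part \<phi> n x)"
proof -
  have "comb b (weight_part \<phi> n x) = (\<Sum>s\<in>Poly_Mapping.keys x. scale (Poly_Mapping.lookup (weight_part \<phi> n x) s) (b s))"
    by (rule comb_superset) (auto simp: keys_weight_part)
  then show ?thesis
    by (auto simp: slice_def comb_def lookup_weight_part intro: sum.cong)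
qed

lemma slice_add: "slice \<phi> b (x + y) n = slice \<phi> b x n + slice \<phi> b y n"
  by (simp add: slice_def comb_add)

lemma slice_scale: "slice \<phi> b (Poly_Mapping.map (\<lambda>z. c * z) x) n = scale c (slice \<phi> b x n)"
  by (simp add: slice_def comb_scale)

lemma slice_single: "slice \<phi> b (Poly_Mapping.single s c) n = (if \<phi> s = n then scale c (b s) else 0)"
  by (simp add: slice_def)

lemma slice_sum: "slice \<phi> b (sum f I) n = (\<Sum>i\<in>I. slice \<phi> b (f i) n)"
  by (simp add: slice_def comb_sum)

lemma slice_diff: "slice \<phi> b (x - y) n = slice \<phi> b x n - slice \<phi> b y n"
  using slice_add[of \<phi> b "x - y" y n] by (simp add: algebra_simps)

lemma finite_slice_nonzero: "finite {n. slice \<phi> b x n \<noteq> 0}"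
proof (rule finite_subset)
  have "slice \<phi> b x n = 0" if "n \<notin> \<phi> ` Poly_Mapping.keys x" for n
    unfolding slice_def comb_def using that by (intro sum.neutral) auto
  then show "{n. slice \<phi> b x n \<noteq> 0} \<subseteq> \<phi> ` Poly_Mapping.keys x" by blast
qed simp

lemma slice_in_span: "slice \<phi> b x n \<in> span (b ` {s. \<phi> s = n})"
  unfolding slice_eq_comb_weight_part by (rule comb_in_span) (auto simp: keys_weight_part)

lemma sum_slice_mult_slice:
  "(\<Sum>i\<le>n. slice \<phi> b x i * slice \<phi> b y (n - i)) =
    (\<Sum>s\<in>Poly_Mapping.keys x. \<Sum>s'\<in>Poly_Mapping.keys y.
      if \<phi> s + \<phi> s' = n
      then scale (Poly_Mapping.lookup x s * Poly_Mapping.lookup y s') (b s * b s') else 0)"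
proof -
  let ?c = "\<lambda>s s'. scale (Poly_Mapping.lookup x s * Poly_Mapping.lookup y s') (b s * b s')"
  have "(\<Sum>i\<le>n. slice \<phi> b x i * slice \<phi> b y (n - i)) =
    (\<Sum>i\<le>n. \<Sum>s\<in>Poly_Mapping.keys x. \<Sum>s'\<in>Poly_Mapping.keys y.
      if i = \<phi> s then (if \<phi> s' = n - \<phi> s then ?c s s' else 0) else 0)"
    unfolding slice_def comb_def sum_product
    by (intro sum.cong) (auto simp: mult_scale_left mult_scale_right)
  also have "\<dots> = (\<Sum>s\<in>Poly_Mapping.keys x. \<Sum>i\<le>n. \<Sum>s'\<in>Poly_Mapping.keys y.
      if i = \<phi> s then (if \<phi> s' = n - \<phi> s then ?c s s' else 0) else 0)"
    by (rule sum.swap)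
  also have "\<dots> = (\<Sum>s\<in>Poly_Mapping.keys x. \<Sum>s'\<in>Poly_Mapping.keys y. \<Sum>i\<le>n.
      if i = \<phi> s then (if \<phi> s' = n - \<phi> s then ?c s s' else 0) else 0)"
    by (intro sum.cong refl sum.swap)
  \<comment> \<open>The range i \<le> n guards the truncated subtraction: with i = \<phi> s it turns
    the condition on s' into \<phi> s + \<phi> s' = n.\<close>
  also have "\<dots> = (\<Sum>s\<in>Poly_Mapping.keys x. \<Sum>s'\<in>Poly_Mapping.keys y.
      if \<phi> s + \<phi> s' = n then ?c s s' else 0)"
    by (intro sum.cong refl) auto
  finally show ?thesis .
qed

end

section \<open>The associated graded ring as a twisted semigroup algebra\<close>

context weighted_basis_algebra
begin

lemma slice_in_F: "slice \<phi> b x n \<in> F n"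
  using slice_in_span[of \<phi> b x n] span_mono[of "b ` {s. \<phi> s = n}" "b ` {s. \<phi> s \<le> n}"]
  by (auto simp: F_def)

lemma slice_mult:
  "cls (slice \<phi> b x) \<otimes>\<^bsub>gr\<^esub> cls (slice \<phi> b y) = cls (slice \<phi> b (x \<otimes>\<^bsub>twisted_semigroup_algebra \<alpha>\<^esub> y))"
proof -
  have "(\<Sum>i\<le>n. slice \<phi> b x i * slice \<phi> b y (n - i))
      - slice \<phi> b (x \<otimes>\<^bsub>twisted_semigroup_algebra \<alpha>\<^esub> y) n \<in> P n" for n
  proof -
    let ?c = "\<lambda>s s'. Poly_Mapping.lookup x s * Poly_Mapping.lookup y s'"
    have "slice \<phi> b (x \<otimes>\<^bsub>twisted_semigroup_algebra \<alpha>\<^esub> y) n =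
      (\<Sum>s\<in>Poly_Mapping.keys x. \<Sum>s'\<in>Poly_Mapping.keys y.
      if \<phi> s + \<phi> s' = n then scale (?c s s' * \<alpha> s s') (b (s + s')) else 0)"
      by (simp add: twisted_semigroup_algebra_def slice_sum slice_single \<phi>_add)
    \<comment> \<open>Term by term the difference is a multiple of the error that defines
      \<alpha>.\<close>
    then have "(\<Sum>i\<le>n. slice \<phi> b x i * slice \<phi> b y (n - i))
      - slice \<phi> b (x \<otimes>\<^bsub>twisted_semigroup_algebra \<alpha>\<^esub> y) n =
      (\<Sum>s\<in>Poly_Mapping.keys x. \<Sum>s'\<in>Poly_Mapping.keys y. if \<phi> s + \<phi> s' = n
        then scale (?c s s') (b s * b s' - scale (\<alpha> s s') (b (s + s'))) else 0)"
      unfolding sum_slice_mult_slice by (simp only: sum_subtractf[symmetric])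
        (intro sum.cong refl, simp add: scale_right_diff_distrib)
    also have "\<dots> \<in> P n"
      using \<alpha> by (intro subspace_sum[OF subspace_P])
        (auto simp: \<phi>_add subspace_0[OF subspace_P] intro!: subspace_scale[OF subspace_P])
    finally show ?thesis .
  qed
  then show ?thesis
    by (simp add: mult_gr slice_in_F cls_eq_iff)
qed

lemma slice_one: "cls (slice \<phi> b \<one>\<^bsub>twisted_semigroup_algebra \<alpha>\<^esub>) = \<one>\<^bsub>gr\<^esub>"
proof -
  have "slice \<phi> b \<one>\<^bsub>twisted_semigroup_algebra \<alpha>\<^esub> = (\<lambda>n. if n = 0 then 1 else 0)"
    by (auto simp: twisted_semigroup_algebra_def slice_single \<phi>_zero fun_eq_iff b_zero \<alpha>_nonzero)
  then show ?thesis by (simp add: one_gr)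
qed

lemma inj_cls_slice: "inj (\<lambda>x. cls (slice \<phi> b x))"
proof (rule injI)
  fix x y assume "cls (slice \<phi> b x) = cls (slice \<phi> b y)"
  then have *: "comb b (weight_part \<phi> n (x - y)) \<in> P n" for n
    by (simp add: cls_eq_iff slice_eq_comb_weight_part[symmetric] slice_diff)
  have "Poly_Mapping.keys (x - y) = {}"
  proof (rule equals0I)
    fix s assume "s \<in> Poly_Mapping.keys (x - y)"
    then show False using *[of "\<phi> s"] unfolding comb_mem_filt_pred_iff keys_weight_part by auto
  qed
  then show "x = y" by simp
qed

text \<open>Modulo \<open>P n\<close> only the part of weight exactly n of a representative in
  \<open>F n\<close> survives; these parts are added up over the finitely many levels with a nonzero
  representative.\<close>

lemma cls_slice_surj:
  assumes "y \<in> carrier gr"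
  shows "\<exists>x. y = cls (slice \<phi> b x)"
proof -
  obtain a where a: "y = cls a" "\<And>n. a n \<in> F n" "finite {n. a n \<noteq> 0}"
    using carrier_grE[OF assms] by blast
  have "\<exists>d. Poly_Mapping.keys d \<subseteq> {s. \<phi> s \<le> n} \<and> a n = comb b d" for n
    using span_image_comb[OF a(2)[of n, unfolded F_def]] by blast
  then obtain d where d: "\<And>n. Poly_Mapping.keys (d n) \<subseteq> {s. \<phi> s \<le> n}" "\<And>n. a n = comb b (d n)"
    by metis
  let ?N = "{n. a n \<noteq> 0}"
  define x where "x = (\<Sum>n\<in>?N. weight_part \<phi> n (d n))"
  have "a n - slice \<phi> b x n \<in> P n" for n
  proof -
    have tp: "slice \<phi> b (weight_part \<phi> m (d m)) n = (if m = n then comb b (weight_part \<phi> n (d n)) else 0)" for m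
    proof -
      have "weight_part \<phi> n (weight_part \<phi> m (d m)) = (if m = n then weight_part \<phi> n (d n) else 0)"
        by (rule poly_mapping_eqI) (simp add: lookup_weight_part)
      then show ?thesis by (simp add: slice_eq_comb_weight_part)
    qed
    have "slice \<phi> b x n = (if n \<in> ?N then comb b (weight_part \<phi> n (d n)) else 0)"
      using a(3) by (simp add: x_def slice_sum tp)
    moreover have "comb b (d n) - comb b (weight_part \<phi> n (d n)) \<in> P n"
    proof -
      have "comb b (d n - weight_part \<phi> n (d n)) \<in> P n"
        unfolding comb_mem_filt_pred_iff
      proof
        fix s assume "s \<in> Poly_Mapping.keys (d n - weight_part \<phi> n (d n))"
        then have "\<phi> s \<noteq> n" "s \<in> Poly_Mapping.keys (d n)"
          by (auto simp: in_keys_iff lookup_minus lookup_weight_part split: if_splits)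
        then show "\<phi> s < n" using d(1)[of n] by auto
      qed
      moreover have "comb b (d n - weight_part \<phi> n (d n)) = comb b (d n) - comb b (weight_part \<phi> n (d n))"
        using comb_add[of b "d n - weight_part \<phi> n (d n)" "weight_part \<phi> n (d n)"] by (simp add: algebra_simps)
      ultimately show ?thesis by simp
    qed
    ultimately show ?thesis
      using d(2)[of n] by (auto simp: subspace_0[OF subspace_P])
  qed
  then show ?thesis using a(1) cls_eq_iff by blast
qed

lemma cls_slice_algebra_iso: "(\<lambda>x. cls (slice \<phi> b x)) \<in> algebra_iso (twisted_semigroup_algebra \<alpha>) gr"
proof -
  have carrier: "cls (slice \<phi> b x) \<in> carrier gr" for x
    using finite_slice_nonzero[of \<phi> b x] subspace_0[OF subspace_P]
    by (intro cls_in_carrier slice_in_F) (auto elim!: rev_finite_subset)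
  have "bij_betw (\<lambda>x. cls (slice \<phi> b x)) UNIV (carrier gr)"
    using inj_cls_slice cls_slice_surj carrier by (auto simp: bij_betw_def)
  then show ?thesis
    using carrier
    unfolding algebra_iso_def ring_iso_def ring_hom_def
    by (auto simp: slice_mult slice_one add_gr smult_gr)
      (auto simp: twisted_semigroup_algebra_def slice_add[abs_def] slice_scale[abs_def])
qed

lemma degeneration:
  "has_quantum_affine_toric_degeneration TYPE('s) scale l D"
  unfolding has_quantum_affine_toric_degeneration_def quantum_positive_affine_toric_variety_def
proof (intro exI[of _ F] exI[of _ \<alpha>] conjI bexI[of _ "\<lambda>x. cls (slice \<phi> b x)"] allI impI)
  fix s :: 's assume "s \<noteq> 0"
  obtain u where u: "u \<in> NN l" "b s \<in> D u" using b_homogeneous by blast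
  \<comment> \<open>The first l coordinates carry the degree in the algebra and coordinate l the
    filtration level, as in \<open>assoc_grading\<close>.\<close>
  define v where "v = u + Poly_Mapping.single l (\<phi> s)"
  have v: "Poly_Mapping.lookup v l = \<phi> s" "Poly_Mapping.update l 0 v = u"
    using NN_lookup[OF u(1)]
    by (auto simp: v_def lookup_add lookup_update lookup_single when_def intro!: poly_mapping_eqI)
  have "v \<in> NN (l + 1)"
    using NN_lookup[OF u(1)] by (auto simp: NN_iff v_def lookup_add lookup_single)
  moreover have "v \<noteq> 0" using v(1) \<phi>_eq_0[of s] \<open>s \<noteq> 0\<close> by auto
  moreover have "cls (slice \<phi> b (Poly_Mapping.single s 1)) \<in> assoc_grading l D F v"
    unfolding assoc_grading_def v Let_def
    using u(2) b_in_F[of s] by (auto simp: cls_def slice_single cls_apply_zero)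
  ultimately show "\<exists>v\<in>NN (l + 1). v \<noteq> 0 \<and>
      cls (slice \<phi> b (Poly_Mapping.single s 1)) \<in> assoc_grading l D F v" by blast
qed (rule graded_filtration_F two_cocycle_\<alpha> cls_slice_algebra_iso)+

end

section \<open>From a degeneration to a weighted basis\<close>

locale toric_degeneration = filtered_algebra scale l D F
  for scale :: "'k::field \<Rightarrow> 'a::ring_1 \<Rightarrow> 'a" and l D F +
  fixes \<alpha> :: "'s::comm_monoid_add \<Rightarrow> 's \<Rightarrow> 'k" and h :: "('s \<Rightarrow>\<^sub>0 'k) \<Rightarrow> nat \<Rightarrow> 'a set"
  assumes cocycle: "two_cocycle \<alpha>"
    and iso: "h \<in> algebra_iso (twisted_semigroup_algebra \<alpha>) gr"
    and homogeneous: "s \<noteq> 0 \<Longrightarrow>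
      \<exists>v\<in>NN (l + 1). v \<noteq> 0 \<and> h (Poly_Mapping.single s 1) \<in> assoc_grading l D F v"
begin

lemma \<alpha>_nonzero: "\<alpha> s s' \<noteq> 0"
  using cocycle by (simp add: two_cocycle_def)

lemma h_add: "h (x + y) = h x \<oplus>\<^bsub>gr\<^esub> h y"
  and h_scale: "h (Poly_Mapping.map (\<lambda>z. c * z) x) = c \<odot>\<^bsub>gr\<^esub> h x"
  and h_one: "h (Poly_Mapping.single 0 (inverse (\<alpha> 0 0))) = \<one>\<^bsub>gr\<^esub>"
  and h_mult: "h (x \<otimes>\<^bsub>twisted_semigroup_algebra \<alpha>\<^esub> y) = h x \<otimes>\<^bsub>gr\<^esub> h y"
  and h_inj: "inj h"
  and h_surj: "range h = carrier gr"
  using iso unfolding algebra_iso_def ring_iso_def ring_hom_def bij_betw_def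
  by (auto simp: twisted_semigroup_algebra_def)

lemma map_times_single:
  "Poly_Mapping.map (\<lambda>z. c * z) (Poly_Mapping.single s d) = Poly_Mapping.single s (c * d :: 'k)"
  by (rule poly_mapping_eqI) (simp add: lookup_map_times lookup_single when_def)

text \<open>Homogeneity for the finer grading supplies a representative that is homogeneous in the
  algebra and sits at one filtration level. The case s = 0 is not covered by the grading hypothesis
  and comes from the unit. The last conjunct records that the degree is nonzero, which later
  excludes nonzero s at level 0.\<close>

lemma h_single_representative:
  "\<exists>n a u. u \<in> NN l \<and> a \<in> F n \<inter> D u \<and>
    h (Poly_Mapping.single s 1) = cls (\<lambda>m. if m = n then a else 0) \<and> (s \<noteq> 0 \<longrightarrow> n \<noteq> 0 \<or> u \<noteq> 0)"
proof (cases "s = 0")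
  case True
  have "Poly_Mapping.single (0::'s) 1
      = Poly_Mapping.map (\<lambda>z. \<alpha> 0 0 * z) (Poly_Mapping.single 0 (inverse (\<alpha> 0 0)))"
    by (simp add: map_times_single \<alpha>_nonzero)
  then have "h (Poly_Mapping.single 0 1) = cls (\<lambda>m. scale (\<alpha> 0 0) (if m = 0 then 1 else 0))"
    using h_scale[of "\<alpha> 0 0" "Poly_Mapping.single 0 (inverse (\<alpha> 0 0))"]
    by (simp only: h_one one_gr smult_gr)
  also have "\<dots> = cls (\<lambda>m. if m = 0 then scale (\<alpha> 0 0) 1 else 0)"
    by (rule arg_cong[of _ _ cls]) auto
  finally show ?thesis
    using True NN_zero by (intro exI[of _ 0] exI[of _ "scale (\<alpha> 0 0) 1"]) (auto simp: F_zero connected)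
next
  case False
  then obtain v where v: "v \<in> NN (l + 1)" "v \<noteq> 0"
    "h (Poly_Mapping.single s 1) \<in> assoc_grading l D F v" using homogeneous by blast
  let ?n = "Poly_Mapping.lookup v l" and ?u = "Poly_Mapping.update l 0 v"
  obtain a where a: "a \<in> F ?n \<inter> D ?u" "h (Poly_Mapping.single s 1) ?n = (+) a ` P ?n"
    "\<And>m. m \<noteq> ?n \<Longrightarrow> h (Poly_Mapping.single s 1) m = P m"
    using v(3) by (auto simp: assoc_grading_def Let_def)
  have "?u \<in> NN l" using NN_lookup[OF v(1)] by (auto simp: NN_iff lookup_update)
  moreover have "h (Poly_Mapping.single s 1) = cls (\<lambda>m. if m = ?n then a else 0)"
    using a by (auto simp: fun_eq_iff cls_def)
  moreover have "?n \<noteq> 0 \<or> ?u \<noteq> 0"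
  proof (rule ccontr)
    assume "\<not> ?thesis"
    then have "Poly_Mapping.lookup v l = 0" "\<And>k. Poly_Mapping.lookup ?u k = 0" by auto
    then have "Poly_Mapping.lookup v k = 0" for k by (metis lookup_update)
    then show False using v(2) by (simp add: poly_mapping_eq_iff fun_eq_iff)
  qed
  ultimately show ?thesis using a(1) by blast
qed

lemma ex_weighted_basis: "\<exists>(\<phi> :: 's \<Rightarrow> nat) b. weighted_basis \<phi> b"
proof -
  \<comment> \<open>Bundling the conditions lets one application of choice produce levels,
    representatives and degrees together.\<close>
  define Q where "Q s n a u \<longleftrightarrow> u \<in> NN l \<and> a \<in> F n \<inter> D u \<and>
    h (Poly_Mapping.single s 1) = cls (\<lambda>m. if m = n then a else 0) \<and> (s \<noteq> 0 \<longrightarrow> n \<noteq> 0 \<or> u \<noteq> 0)"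
    for s n a u
  have "\<forall>s. \<exists>n a u. Q s n a u" using h_single_representative unfolding Q_def by blast
  then obtain \<phi> b u where "\<And>s. Q s (\<phi> s) (b s) (u s)" by metis
  then have u: "u s \<in> NN l" and b: "b s \<in> F (\<phi> s)" "b s \<in> D (u s)"
    and hX: "h (Poly_Mapping.single s 1) = cls (\<lambda>m. if m = \<phi> s then b s else 0)"
    and nz: "s \<noteq> 0 \<Longrightarrow> \<phi> s \<noteq> 0 \<or> u s \<noteq> 0" for s
    by (auto simp: Q_def)
  have h0: "h 0 = cls (\<lambda>_. 0)"
    using h_scale[of 0 "Poly_Mapping.single 0 1"] unfolding map_times_single hX smult_gr by simp
  have h_single: "h (Poly_Mapping.single s c) = cls (slice \<phi> b (Poly_Mapping.single s c))" for s c
  proof -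
    have "h (Poly_Mapping.single s c) = cls (\<lambda>m. scale c (if m = \<phi> s then b s else 0))"
      using h_scale[of c "Poly_Mapping.single s 1"] by (simp add: map_times_single hX smult_gr)
    also have "(\<lambda>m. scale c (if m = \<phi> s then b s else 0)) = slice \<phi> b (Poly_Mapping.single s c)"
      by (auto simp: slice_single)
    finally show ?thesis .
  qed
  \<comment> \<open>By linearity \<open>h\<close> is determined by its values on the basis, so it
    has the same form as the isomorphism built in the other direction.\<close>
  have h_eq: "h x = cls (slice \<phi> b x)" for x
  proof -
    have "h (\<Sum>s\<in>K. Poly_Mapping.single s (Poly_Mapping.lookup x s))
        = cls (slice \<phi> b (\<Sum>s\<in>K. Poly_Mapping.single s (Poly_Mapping.lookup x s)))" if "finite K" for K
      using that
    proof (induction K rule: finite_induct)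
      case empty
      show ?case by (simp add: h0 slice_def[abs_def])
    next
      case (insert s K)
      then show ?case by (simp add: h_add h_single add_gr slice_add[abs_def])
    qed
    moreover have "(\<Sum>s\<in>Poly_Mapping.keys x. Poly_Mapping.single s (Poly_Mapping.lookup x s)) = x"
      by (rule poly_mapping_eqI) (auto simp: lookup_sum lookup_single when_def in_keys_iff)
    ultimately show ?thesis by (metis finite_keys)
  qed
  have h_eq_0: "x = 0" if "\<And>n. slice \<phi> b x n \<in> P n" for x
  proof -
    have "h x = h 0" unfolding h_eq[of x] h0 cls_eq_iff using that by simp
    then show ?thesis using h_inj by (simp add: inj_eq)
  qed
  have b_notin: "b s \<notin> P (\<phi> s)" for s
  proof
    assume "b s \<in> P (\<phi> s)"
    then have "Poly_Mapping.single s (1::'k) = 0"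
      by (intro h_eq_0) (auto simp: slice_single subspace_0[OF subspace_P])
    then show False by (metis lookup_single_eq lookup_zero zero_neq_one)
  qed
  have mult: "\<phi> (s + s') = \<phi> s + \<phi> s' \<and> b s * b s' - scale (\<alpha> s s') (b (s + s')) \<in> P (\<phi> (s + s'))"
    for s s'
  proof -
    have "Poly_Mapping.single s 1 \<otimes>\<^bsub>twisted_semigroup_algebra \<alpha>\<^esub> Poly_Mapping.single s' 1
        = Poly_Mapping.single (s + s') (\<alpha> s s')"
      by (simp add: twisted_semigroup_algebra_def)
    then have "cls (slice \<phi> b (Poly_Mapping.single (s + s') (\<alpha> s s')))
        = cls (slice \<phi> b (Poly_Mapping.single s 1)) \<otimes>\<^bsub>gr\<^esub> cls (slice \<phi> b (Poly_Mapping.single s' 1))"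
      unfolding h_eq[symmetric] by (metis h_mult)
    also have "\<dots> = cls (\<lambda>n. \<Sum>i\<le>n. slice \<phi> b (Poly_Mapping.single s 1) i
        * slice \<phi> b (Poly_Mapping.single s' 1) (n - i))"
      using b subspace_0[OF subspace_F] by (intro mult_gr) (auto simp: slice_single)
    also have "\<dots> = cls (\<lambda>n. if \<phi> s + \<phi> s' = n then b s * b s' else 0)"
      by (simp add: sum_slice_mult_slice keys_single cong: if_cong)
    finally have *: "(if \<phi> s + \<phi> s' = n then b s * b s' else 0)
        - (if \<phi> (s + s') = n then scale (\<alpha> s s') (b (s + s')) else 0) \<in> P n" for n
      by (simp add: cls_eq_iff[of "\<lambda>n. if \<phi> s + \<phi> s' = n then b s * b s' else 0", symmetric]
          slice_single[abs_def] cls_eq_iff eq_commute)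
    \<comment> \<open>The product of the two classes is a nonzero multiple of the class of s + s'.
      If the levels differed, the entry at level \<phi>(s + s') would force that class to
      vanish.\<close>
    have "\<phi> (s + s') = \<phi> s + \<phi> s'"
    proof (rule ccontr)
      assume "\<phi> (s + s') \<noteq> \<phi> s + \<phi> s'"
      then have "- scale (\<alpha> s s') (b (s + s')) \<in> P (\<phi> (s + s'))" using *[of "\<phi> (s + s')"] by auto
      then have "scale (- inverse (\<alpha> s s')) (- scale (\<alpha> s s') (b (s + s'))) \<in> P (\<phi> (s + s'))"
        by (rule subspace_scale[OF subspace_P])
      then show False using b_notin \<alpha>_nonzero by simp
    qed
    then show ?thesis using *[of "\<phi> (s + s')"] by simp
  qed
  \<comment> \<open>At level 0 only scalars occur, of degree 0, whereas a nonzero s at level 0 would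
    have a representative of nonzero degree; that representative would then be 0.\<close>
  have eq0: "s = 0" if "\<phi> s = 0" for s
  proof (rule ccontr)
    assume "s \<noteq> 0"
    then have "u s \<noteq> 0" using nz that by blast
    moreover have "b s \<in> D 0" using b(1)[of s] that by (simp add: F_zero connected)
    ultimately have "b s = 0"
      using homogeneous_degree_unique[OF u NN_zero b(2)] by blast
    then show False using b_notin[of s] subspace_0[OF subspace_P] by simp
  qed
  \<comment> \<open>Surjectivity of \<open>h\<close> matches the class of an element of
    \<open>F n\<close> by a slice of weight n, and the remainder lies in the previous step.\<close>
  have F_span: "F n \<subseteq> span (b ` {s. \<phi> s \<le> n})" for n
  proof (induction n rule: less_induct)
    case (less n)
    have P: "P n \<subseteq> span (b ` {s. \<phi> s \<le> n})"
    proof (cases n)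
      case 0
      then show ?thesis by (simp add: filt_pred_def span_zero)
    next
      case (Suc m)
      have "span (b ` {s. \<phi> s \<le> m}) \<subseteq> span (b ` {s. \<phi> s \<le> n})"
        using Suc by (intro span_mono) auto
      then show ?thesis using less.IH[of m] Suc by (auto simp: filt_pred_def)
    qed
    show ?case
    proof
      fix x assume x: "x \<in> F n"
      have "cls (\<lambda>m. if m = n then x else 0) \<in> carrier gr"
        using x subspace_0[OF subspace_F] subspace_0[OF subspace_P]
        by (intro cls_in_carrier) (auto intro!: finite_subset[of _ "{n}"] split: if_splits)
      then obtain z where "h z = cls (\<lambda>m. if m = n then x else 0)" using h_surj by (metis imageE)
      then have "\<forall>m. (if m = n then x else 0) - slice \<phi> b z m \<in> P m"
        unfolding h_eq by (metis (mono_tags, lifting) cls_eq_iff)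
      then have "x - slice \<phi> b z n \<in> P n" by (metis (full_types))
      then have "x - slice \<phi> b z n \<in> span (b ` {s. \<phi> s \<le> n})" using P by blast
      moreover have "slice \<phi> b z n \<in> span (b ` {s. \<phi> s \<le> n})"
        using slice_in_span[of \<phi> b z n] span_mono[of "b ` {s. \<phi> s = n}" "b ` {s. \<phi> s \<le> n}"] by auto
      ultimately show "x \<in> span (b ` {s. \<phi> s \<le> n})" using span_add by fastforce
    qed
  qed
  have P_span: "P n \<subseteq> span (b ` {s. \<phi> s < n})" for n
    using F_span[of "n - 1"] by (cases n) (auto simp: filt_pred_def span_zero less_Suc_eq_le)
  have comb0: "d = 0" if d: "comb b d = 0" for d
  proof (rule ccontr)
    assume "d \<noteq> 0"
    \<comment> \<open>The terms of \<open>d\<close> below the top weight lie in \<open>P n\<close>,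
      so a vanishing combination puts its top part there too; injectivity of \<open>h\<close> then
      makes the top part zero.\<close>
    define n where "n = Max (\<phi> ` Poly_Mapping.keys d)"
    have n: "n \<in> \<phi> ` Poly_Mapping.keys d" "\<And>s. s \<in> Poly_Mapping.keys d \<Longrightarrow> \<phi> s \<le> n"
      unfolding n_def using \<open>d \<noteq> 0\<close> by (auto intro: Max_in)
    let ?e = "weight_part \<phi> n d"
    have "comb b (d - ?e) \<in> P n"
      unfolding comb_def
    proof (intro subspace_sum[OF subspace_P] subspace_scale[OF subspace_P])
      fix s assume "s \<in> Poly_Mapping.keys (d - ?e)"
      then have "\<phi> s \<noteq> n" "s \<in> Poly_Mapping.keys d"
        by (auto simp: in_keys_iff lookup_minus lookup_weight_part split: if_splits)
      then have "\<phi> s < n" using n(2) by force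
      then show "b s \<in> P n" using b(1) F_subset_P by blast
    qed
    moreover have "comb b (d - ?e) = - comb b ?e"
      using comb_add[of b "d - ?e" ?e] d by (simp add: eq_neg_iff_add_eq_0)
    ultimately have "slice \<phi> b d n \<in> P n"
      using subspace_neg[OF subspace_P] by (fastforce simp: slice_eq_comb_weight_part)
    moreover have "weight_part \<phi> m ?e = (if m = n then ?e else 0)" for m
      by (rule poly_mapping_eqI) (simp add: lookup_weight_part)
    ultimately have "?e = 0"
      by (intro h_eq_0) (auto simp: slice_eq_comb_weight_part subspace_0[OF subspace_P])
    then have "Poly_Mapping.keys ?e = {}" by simp
    then show False using n(1) unfolding keys_weight_part by auto
  qed
  have basis: "inj b" "independent (range b)"
    using independent_range_if_comb[of b] comb0 by blast+
  \<comment> \<open>Finite dimension of \<open>F n\<close> bounds the number of independent elements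
    \<open>b s\<close> that it contains.\<close>
  have "finite {s. \<phi> s \<le> n}" for n
  proof -
    obtain B where B: "finite B" "F n = span B"
      using F_finite_dimensional[of n] by (auto simp: finite_dimensional_def)
    have "b ` {s. \<phi> s \<le> n} \<subseteq> span B" using b(1) F_mono B(2) by blast
    moreover have "independent (b ` {s. \<phi> s \<le> n})"
      using basis(2) by (rule independent_mono) auto
    ultimately have "finite (b ` {s. \<phi> s \<le> n})"
      using independent_span_bound[OF B(1)] by blast
    then show ?thesis using basis(1) finite_imageD inj_on_subset by blast
  qed
  moreover have "span (range b) = UNIV"
  proof -
    have "F n \<subseteq> span (range b)" for n
      using F_span[of n] span_mono[of "b ` {s. \<phi> s \<le> n}" "range b"] by auto
    then show ?thesis using F_UN by blast
  qed
  moreover have "\<exists>c. c \<noteq> 0 \<and> b s * b s' - scale c (b (s + s')) \<in> span (b ` {u. \<phi> u < \<phi> (s + s')})"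
    for s s' using mult[of s s'] P_span \<alpha>_nonzero by blast
  ultimately have "weighted_basis \<phi> b"
    unfolding weighted_basis_def using basis mult eq0 u b(2) by blast
  then show ?thesis by blast
qed

end

theorem mainTheorem4:
  fixes scale :: "'k::field \<Rightarrow> 'a::ring_1 \<Rightarrow> 'a"
    and l :: nat
    and D :: "(nat \<Rightarrow>\<^sub>0 nat) \<Rightarrow> 'a set"
  assumes "positive_affine_semigroup TYPE('s::comm_monoid_add)"
    and "connected_graded_algebra scale l D"
    and "noetherian TYPE('a)"
  shows "has_quantum_affine_toric_degeneration TYPE('s) scale l D \<longleftrightarrow>
    (\<exists>t. \<exists>\<iota> :: 's \<Rightarrow> (nat \<Rightarrow>\<^sub>0 nat). monoid_embedding t \<iota> \<and>
       (\<exists>b :: 's \<Rightarrow> 'a. semigroup_basis scale l D (\<lambda>s s'. \<iota> s < \<iota> s') b))"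
proof -
  interpret connected_graded_algebra scale l D by fact
  show ?thesis
  proof
    assume "has_quantum_affine_toric_degeneration TYPE('s) scale l D"
    then obtain F \<alpha> h where F: "graded_filtration scale l D F" and \<alpha>: "two_cocycle (\<alpha> :: 's \<Rightarrow> 's \<Rightarrow> 'k)"
      and h: "h \<in> algebra_iso (twisted_semigroup_algebra \<alpha>) (assoc_graded scale F)"
        "\<And>s. s \<noteq> 0 \<Longrightarrow> \<exists>v\<in>NN (l + 1). v \<noteq> 0 \<and> h (Poly_Mapping.single s 1) \<in> assoc_grading l D F v"
      unfolding has_quantum_affine_toric_degeneration_def quantum_positive_affine_toric_variety_def
      by blast
    interpret toric_degeneration scale l D F \<alpha> h
      by unfold_locales (fact F \<alpha> h)+
    obtain \<phi> :: "'s \<Rightarrow> nat" and b where wb: "weighted_basis \<phi> b" using ex_weighted_basis by blast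
    obtain m and \<psi> :: "'s \<Rightarrow> (nat \<Rightarrow>\<^sub>0 nat)" where "monoid_embedding m \<psi>"
      using assms(1) by (auto simp: positive_affine_semigroup_def)
    from semigroup_basis_if_weighted_basis[OF this wb]
    show "\<exists>t. \<exists>\<iota> :: 's \<Rightarrow> (nat \<Rightarrow>\<^sub>0 nat). monoid_embedding t \<iota> \<and>
       (\<exists>b :: 's \<Rightarrow> 'a. semigroup_basis scale l D (\<lambda>s s'. \<iota> s < \<iota> s') b)"
      by blast
  next
    assume "\<exists>t. \<exists>\<iota> :: 's \<Rightarrow> (nat \<Rightarrow>\<^sub>0 nat). monoid_embedding t \<iota> \<and>
       (\<exists>b :: 's \<Rightarrow> 'a. semigroup_basis scale l D (\<lambda>s s'. \<iota> s < \<iota> s') b)"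
    then obtain t \<iota> b where \<iota>: "monoid_embedding t (\<iota> :: 's \<Rightarrow> (nat \<Rightarrow>\<^sub>0 nat))"
      and b: "semigroup_basis scale l D (\<lambda>s s'. \<iota> s < \<iota> s') b" by blast
    obtain n and g :: "nat \<Rightarrow> 's" where g: "\<And>s. \<exists>w. set w \<subseteq> {..<n} \<and> sum_list (map g w) = s"
      using positive_affine_semigroup_generators[OF assms(1)] by blast
    interpret generated_semigroup_basis scale l D t \<iota> b n g
      by unfold_locales (fact \<iota> b g)+
    obtain \<phi> :: "'s \<Rightarrow> nat" and b' where wb: "weighted_basis \<phi> b'" using ex_weighted_basis by blast
    interpret W: weighted_basis_algebra scale l D \<phi> b'
      by unfold_locales (fact wb)
    show "has_quantum_affine_toric_degeneration TYPE('s) scale l D"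
      by (rule W.degeneration)
  qed
qed

end
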